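(* Let $n\in\mathbb{Z}_{\geq 1}$ and $k\in\{1,2\}$. (a) The sets $T_{\mathrm{HOR}1}(n,\mathbb{R})$ and $T_{\mathrm{HOR}2}(n,\mathbb{R})$ are subspaces of $T(n,\mathbb{R})$ and satisfy the following properties. ($\alpha$) $T_{\mathrm{HOR}k}(n,\mathbb{R})$ can be represented (via the parametrization by $\underline\beta$ described in the context) by a closed simplex, i.e. the convex hull of $\dim T_{\mathrm{HOR}k}(n,\mathbb{R})+1$ many points in $\mathbb{R}^{\dim T_{\mathrm{HOR}k}(n,\mathbb{R})}$. The dimensions are: for $n$ odd, $\dim T_{\mathrm{HOR}1}(n,\mathbb{R})=\dim T_{\mathrm{HOR}2}(n,\mathbb{R})=\frac{n-1}{2}$; for $n$ even, $\dim T_{\mathrm{HOR}1}(n,\mathbb{R})=\frac n2$ and $\dim T_{\mathrm{HOR}2}(n,\mathbb{R})=\frac{n-2}{2}$. ($\beta$) For each $S\in T_{\mathrm{HOR}k}(n,\mathbb{R})$ the matrix $R^{mat}_{(k)}(S)\in GL(n,\mathbb{R})$ is regular (for each eigenvalue it has only one Jordan block), has all eigenvalues in the unit circle $S^1$, and satisfies $$(-1)^k\cdot S^{-1}S^t=R^{mat}_{(k)}(S)^n .$$ The map $R^{mat}_{(k)}:T_{\mathrm{HOR}k}(n,\mathbb{R})\to GL(n,\mathbb{R})$ is, as a map to $M(n\times n,\mathbb{R})$, affine linear. ($\gamma$) $R^{mat}_{(k)}(S)$ is semisimple (and thus has pairwise different eigenvalues) if and only if $S\in\mathrm{int}(T_{\mathrm{HOR}k}(n,\mathbb{R}))$.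 ($\delta$) $E_n\in\mathrm{int}(T_{\mathrm{HOR}k}(n,\mathbb{R}))$, and $R^{mat}_{(k)}(E_n)$ has the eigenvalues $e^{-2\pi i(j-\frac k2)/n}$, $j\in\{1,\dots,n\}$. Furthermore $T_{\mathrm{HOR}1}(n,\mathbb{R})\cap T_{\mathrm{HOR}2}(n,\mathbb{R})=\{E_n\}$. (b) Let $S_1\in T_{\mathrm{HOR}k}(n,\mathbb{R})$ and let $S:[0,1]\to T_{\mathrm{HOR}k}(n,\mathbb{R})$ be any continuous path with $S(0)=E_n$, $S(1)=S_1$ and $S([0,1))\subset\mathrm{int}(T_{\mathrm{HOR}k}(n,\mathbb{R}))$. Then for $r\in[0,1)$ the eigenvalues of $R^{mat}_{(k)}(S(r))$ are pairwise different, and there are unique continuous functions $\alpha_1,\dots,\alpha_n:[0,1]\to\mathbb{R}$ such that $\alpha_j(0)=0$ for all $j$ and such that $e^{-2\pi i(\alpha_j(r)+j-\frac k2)/n}$, $j\in\{1,\dots,n\}$, are the eigenvalues of $R^{mat}_{(k)}(S(r))$ for all $r\in[0,1]$. The values $\alpha_1(1),\dots,\alpha_n(1)$ are independent of the chosen path $S$ (they define the spectrum $\mathrm{Sp}(S_1)=\sum_{j=1}^n(\alpha_j(1))$).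
   Context: $E_n$ is the $n\times n$ unit matrix, $S^1\subset\mathbb{C}$ the unit circle. $T(n,\mathbb{R})$ is the set of real upper triangular $n\times n$ matrices $S$ with all diagonal entries $1$ such that all eigenvalues of $S^{-1}S^t$ are in $S^1$. Parameter simplices: $T^{scal}_{\mathrm{HOR}1}(n,\mathbb{R})=\{\underline\beta=(\beta_1,\dots,\beta_n)\in[0,1]^n\mid \beta_1\le\dots\le\beta_n,\ \beta_j+\beta_{n+1-j}=1\}$, $T^{scal}_{\mathrm{HOR}2}(n,\mathbb{R})=\{\underline\beta\in[0,1]^n\mid 0=\beta_1\le\dots\le\beta_n,\ \beta_j+\beta_{n+2-j}=1\text{ for }j\ge2\}$. Let $\Pi(\underline\beta)=\prod_{j=1}^n(x-e^{-2\pi i\beta_j})\in\mathbb{R}[x]$ (this map is injective) and $T^{pol}_{\mathrm{HOR}k}(n,\mathbb{R})=\Pi(T^{scal}_{\mathrm{HOR}k}(n,\mathbb{R}))$. A polynomial $p=x^n+p_{n-1}x^{n-1}+\dots+p_0$ (with $p_n:=1$) in this set has all zeros in $S^1$ and satisfies $p_j=(-1)^{k-1}p_{n-j}$, so $p_0=(-1)^{k-1}$; conversely all such real polynomials are in it. For $p\in T^{pol}_{\mathrm{HOR}k}(n,\mathbb{R})$ let $S^{(k)}(p)$ be the upper triangular Toeplitz matrix with $(i,j)$-entry $p_{n-(j-i)}$ for $i\le j$ (first row $(1,p_{n-1},\dots,p_1)$) and $0$ for $i>j$. Define $T_{\mathrm{HOR}k}(n,\mathbb{R}):=S^{(k)}(T^{pol}_{\mathrm{HOR}k}(n,\mathbb{R}))$.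 For $S=S^{(k)}(p)\in T_{\mathrm{HOR}k}(n,\mathbb{R})$, $R^{mat}_{(k)}(S)$ is the companion matrix with first row $(-p_{n-1},-p_{n-2},\dots,-p_1,-p_0)$, with the unit matrix $E_{n-1}$ as the block in rows $2,\dots,n$ and columns $1,\dots,n-1$, and zeros elsewhere; its characteristic polynomial is $p$. $T_{\mathrm{HOR}k}(n,\mathbb{R})$ is identified with $T^{scal}_{\mathrm{HOR}k}(n,\mathbb{R})$ by $S^{(k)}\circ\Pi$; its dimension is the dimension of this simplex, and $\mathrm{int}(T_{\mathrm{HOR}k}(n,\mathbb{R}))$ is the image of the (relative) interior of this simplex (if the dimension is $0$, the interior is the point itself). "Affine linear" means: the restriction of an affine linear map on matrices. $\sum_j(\alpha_j)$ denotes an unordered tuple of real numbers. *)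

theory Defs
  imports
    "HOL-Analysis.Analysis"
    "HOL-Library.Function_Algebras"
    "Jordan_Normal_Form.Jordan_Normal_Form"
    "Jordan_Normal_Form.Gauss_Jordan_Elimination"
begin

text \<open>
  The pointwise vector space structure on functions makes \<^term>\<open>convex hull S\<close>,
  \<^term>\<open>affine_dependent S\<close> and \<^term>\<open>rel_interior S\<close> available for sets of functions
  \<open>nat \<Rightarrow> real\<close>. The space \<open>\<real>\<^sup>m\<close> is the subspace of the functions that vanish
  outside \<open>{1..m}\<close>; there the product topology is the Euclidean topology.
\<close>

instantiation "fun" :: (type, real_vector) real_vector
begin

definition scaleR_fun :: "real \<Rightarrow> ('a \<Rightarrow> 'b) \<Rightarrow> 'a \<Rightarrow> 'b" where
  "scaleR_fun c f = (\<lambda>x. c *\<^sub>R f x)"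

instance
  by standard (auto simp: scaleR_fun_def fun_eq_iff scaleR_add_right scaleR_add_left)

end

definition coord_space :: "nat \<Rightarrow> (nat \<Rightarrow> real) set" where
  "coord_space m = {x. \<forall>j. j \<notin> {1..m} \<longrightarrow> x j = 0}"

text \<open>
  The library constant \<^const>\<open>aff_dim\<close> is restricted to Euclidean spaces; this is the same
  notion for nonempty sets of finite dimension in an arbitrary real vector space.
\<close>

definition affine_dimension :: "'a::real_vector set \<Rightarrow> nat" where
  "affine_dimension V =
     (THE d. \<exists>B. finite B \<and> affine hull B = affine hull V \<and> \<not> affine_dependent B \<and> card B = d + 1)"


abbreviation cmat :: "real mat \<Rightarrow> complex mat" where
  "cmat A \<equiv> map_mat complex_of_real A"

definition T_mat :: "nat \<Rightarrow> real mat set" where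
  "T_mat n = {S \<in> carrier_mat n n.
     upper_triangular S \<and> (\<forall>i<n. S $$ (i,i) = 1) \<and>
     (\<forall>\<mu>. eigenvalue (cmat (the (mat_inverse S) * transpose_mat S)) \<mu> \<longrightarrow> \<mu> \<in> sphere 0 1)}"

definition mat_topology :: "nat \<Rightarrow> real mat topology" where
  "mat_topology n =
     pullback_topology (carrier_mat n n)
       (\<lambda>A (i,j). if i < n \<and> j < n then A $$ (i,j) else 0) euclidean"

definition regular_mat :: "complex mat \<Rightarrow> bool" where
  "regular_mat A \<longleftrightarrow> (\<exists>n_as. jordan_nf A n_as \<and> distinct (map snd n_as))"

definition semisimple_mat :: "complex mat \<Rightarrow> bool" where
  "semisimple_mat A \<longleftrightarrow> (\<exists>D. diagonal_mat D \<and> similar_mat A D)"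

text \<open>The family \<open>\<lambda>\<^sub>1, \<dots>, \<lambda>\<^sub>n\<close> lists the eigenvalues with algebraic multiplicities.\<close>

definition has_eigenvalues :: "nat \<Rightarrow> complex mat \<Rightarrow> (nat \<Rightarrow> complex) \<Rightarrow> bool" where
  "has_eigenvalues n A ev \<longleftrightarrow> char_poly A = (\<Prod>j=1..n. [:- ev j, 1:])"

definition distinct_eigenvalues :: "nat \<Rightarrow> complex mat \<Rightarrow> bool" where
  "distinct_eigenvalues n A \<longleftrightarrow> card {\<mu>. eigenvalue A \<mu>} = n"

definition affine_linear_on :: "nat \<Rightarrow> real mat set \<Rightarrow> (real mat \<Rightarrow> real mat) \<Rightarrow> bool" where
  "affine_linear_on n X f \<longleftrightarrow>
     (\<exists>L C. C \<in> carrier_mat n n \<and> L \<in> carrier_mat n n \<rightarrow> carrier_mat n n \<and>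
        (\<forall>A\<in>carrier_mat n n. \<forall>B\<in>carrier_mat n n. L (A + B) = L A + L B) \<and>
        (\<forall>c. \<forall>A\<in>carrier_mat n n. L (c \<cdot>\<^sub>m A) = c \<cdot>\<^sub>m L A) \<and>
        (\<forall>A\<in>X. f A = L A + C))"


definition T_scal_HOR1 :: "nat \<Rightarrow> (nat \<Rightarrow> real) set" where
  "T_scal_HOR1 n = {\<beta> \<in> coord_space n.
     (\<forall>j\<in>{1..n}. \<beta> j \<in> {0..1}) \<and> mono_on {1..n} \<beta> \<and>
     (\<forall>j\<in>{1..n}. \<beta> j + \<beta> (n + 1 - j) = 1)}"

definition T_scal_HOR2 :: "nat \<Rightarrow> (nat \<Rightarrow> real) set" where
  "T_scal_HOR2 n = {\<beta> \<in> coord_space n.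
     (\<forall>j\<in>{1..n}. \<beta> j \<in> {0..1}) \<and> \<beta> 1 = 0 \<and> mono_on {1..n} \<beta> \<and>
     (\<forall>j\<in>{2..n}. \<beta> j + \<beta> (n + 2 - j) = 1)}"

definition T_scal :: "nat \<Rightarrow> nat \<Rightarrow> (nat \<Rightarrow> real) set" where
  "T_scal k n = (if k = 1 then T_scal_HOR1 n else T_scal_HOR2 n)"

text \<open>
  For parameters in \<^term>\<open>T_scal k n\<close> the product is invariant under complex conjugation,
  so the real polynomial exists (and is unique).
\<close>

definition Pi_poly :: "nat \<Rightarrow> (nat \<Rightarrow> real) \<Rightarrow> real poly" where
  "Pi_poly n \<beta> =
     (THE p. map_poly complex_of_real p = (\<Prod>j=1..n. [:- cis (- 2 * pi * \<beta> j), 1:]))"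

definition T_pol :: "nat \<Rightarrow> nat \<Rightarrow> real poly set" where
  "T_pol k n = Pi_poly n ` T_scal k n"

definition S_mat :: "nat \<Rightarrow> real poly \<Rightarrow> real mat" where
  "S_mat n p = Matrix.mat n n (\<lambda>(i,j). if i \<le> j then coeff p (n - (j - i)) else 0)"

definition T_HOR :: "nat \<Rightarrow> nat \<Rightarrow> real mat set" where
  "T_HOR k n = S_mat n ` T_pol k n"

definition int_T_HOR :: "nat \<Rightarrow> nat \<Rightarrow> real mat set" where
  "int_T_HOR k n = (S_mat n \<circ> Pi_poly n) ` rel_interior (T_scal k n)"

definition dim_T_HOR :: "nat \<Rightarrow> nat \<Rightarrow> nat" where
  "dim_T_HOR k n = affine_dimension (T_scal k n)"

definition companion :: "nat \<Rightarrow> real poly \<Rightarrow> real mat" where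
  "companion n p = Matrix.mat n n
     (\<lambda>(i,j). if i = 0 then - coeff p (n - 1 - j) else if i = j + 1 then 1 else 0)"

text \<open>
  The constant coefficient of \<open>p \<in> T_pol k n\<close> is \<open>(-1)\<^sup>k\<^sup>-\<^sup>1\<close> and its other coefficients are
  entries of \<open>S_mat n p\<close>, so the preimage of a matrix in \<open>T_HOR k n\<close> is unique.
\<close>

definition R_mat :: "nat \<Rightarrow> nat \<Rightarrow> real mat \<Rightarrow> real mat" where
  "R_mat k n S = companion n (inv_into (T_pol k n) (S_mat n) S)"


definition HOR_path :: "nat \<Rightarrow> nat \<Rightarrow> real mat \<Rightarrow> (real \<Rightarrow> real mat) \<Rightarrow> bool" where
  "HOR_path k n S1 S \<longleftrightarrow>
     pathin (subtopology (mat_topology n) (T_HOR k n)) S \<and>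
     S 0 = 1\<^sub>m n \<and> S 1 = S1 \<and> S ` {0..<1} \<subseteq> int_T_HOR k n"

definition eigenvalue_lift ::
  "nat \<Rightarrow> nat \<Rightarrow> (real \<Rightarrow> real mat) \<Rightarrow> (nat \<Rightarrow> real \<Rightarrow> real) \<Rightarrow> bool" where
  "eigenvalue_lift k n S \<alpha> \<longleftrightarrow>
     (\<forall>j\<in>{1..n}. continuous_on {0..1} (\<alpha> j) \<and> \<alpha> j 0 = 0) \<and>
     (\<forall>r\<in>{0..1}. has_eigenvalues n (cmat (R_mat k n (S r)))
        (\<lambda>j. cis (- 2 * pi * (\<alpha> j r + real j - real k / 2) / real n)))"

definition HOR_Sp :: "nat \<Rightarrow> nat \<Rightarrow> real mat \<Rightarrow> real multiset" where
  "HOR_Sp k n S1 =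
     (THE M. \<exists>S \<alpha>. HOR_path k n S1 S \<and> eigenvalue_lift k n S \<alpha> \<and>
        M = image_mset (\<lambda>j. \<alpha> j 1) (mset_set {1..n}))"

end

theory Submission
  imports Defs
    "Jordan_Normal_Form.Jordan_Normal_Form_Uniqueness"
    "Jordan_Normal_Form.Jordan_Normal_Form_Existence"
begin

text \<open>
  The companion matrix \<open>R\<close> of \<open>p\<close> shifts rows, and its first row undoes the leading
  coefficient; multiplying the Toeplitz matrix \<open>S\<close> by \<open>R\<close> from the right \<open>n\<close> times replaces the
  row \<open>p\<^sub>n, p\<^sub>n\<^sub>-\<^sub>1, \<dots>\<close> by minus the complementary coefficients of \<open>p\<close>. Since \<open>p\<close> is palindromic up
  to the sign \<open>-(-1)\<^sup>k\<close>, the result is \<open>(-1)\<^sup>k S\<^sup>t\<close>. A companion matrix has one-dimensional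
  eigenspaces, so it is regular, and it is semisimple iff the roots \<open>exp (-2\<pi>i\<beta>\<^sub>j)\<close> of \<open>p\<close> are distinct,
  which happens exactly in the relative interior of the parameter simplex.

  Folding \<open>\<beta>\<close> along its symmetry identifies the parameter set with the ordered simplex
  \<open>0 \<le> x\<^sub>1 \<le> \<dots> \<le> x\<^sub>m \<le> 1/2\<close>. The map from \<open>\<beta>\<close> to \<open>S\<close> is a continuous injection of a compact
  space into a Hausdorff space, hence a homeomorphism onto its image. A path of matrices therefore is
  a path \<open>\<beta>(r)\<close>, and \<open>\<alpha>\<^sub>j = n \<beta>\<^sub>j - j + k/2\<close> is the required lift. It is the only one because
  on \<open>[0,1)\<close> the roots never collide, so a continuous choice of logarithms of roots cannot jump; in
  particular the values at \<open>1\<close> only depend on the end point.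
\<close>

section \<open>Companion matrices and Toeplitz matrices\<close>

lemma companion_carrier [simp]: "companion n p \<in> carrier_mat n n"
  by (simp add: companion_def)

lemma companion_index [simp]:
  "i < n \<Longrightarrow> j < n \<Longrightarrow> companion n p $$ (i,j) =
     (if i = 0 then - coeff p (n - 1 - j) else if i = j + 1 then 1 else 0)"
  by (simp add: companion_def)

lemma dim_companion [simp]: "dim_row (companion n p) = n" "dim_col (companion n p) = n"
  by (simp_all add: companion_def)

text \<open>Laplace expansion along the last column, which is nonzero only in rows \<open>0\<close>
  and \<open>n\<close>. Deleting row \<open>n\<close> leaves the same problem for \<open>q\<close>;
  deleting row \<open>0\<close> leaves a triangular matrix with diagonal \<open>-1\<close>, whose
  determinant cancels the sign of the cofactor.\<close>

lemma char_poly_companion_pCons: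
  "char_poly (companion (Suc n) (pCons a q)) = pCons a (char_poly (companion n q))"
proof -
  define A where "A = char_poly_matrix (companion (Suc n) (pCons a q))"
  have Ac: "A \<in> carrier_mat (Suc n) (Suc n)"
    unfolding A_def by simp
  have A: "A $$ (i,j) = (if i = j then [:0,1:] else 0)
      + [: - (if i = 0 then - coeff (pCons a q) (n - j) else if i = j + 1 then 1 else 0) :]"
    if "i < Suc n" "j < Suc n" for i j
    using that unfolding A_def char_poly_matrix_def by auto
  have del_n: "mat_delete A n n = char_poly_matrix (companion n q)"
  proof (rule eq_matI)
    fix i j assume "i < dim_row (char_poly_matrix (companion n q))"
      "j < dim_col (char_poly_matrix (companion n q))"
    then have ij: "i < n" "j < n" by (auto simp: char_poly_matrix_def)
    then obtain m where "n = Suc m" by (cases n) auto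
    with ij have "coeff (pCons a q) (n - j) = coeff q (n - 1 - j)"
      by (simp add: Suc_diff_le)
    then show "mat_delete A n n $$ (i, j) = char_poly_matrix (companion n q) $$ (i, j)"
      using ij Ac by (simp add: mat_delete_def A del: coeff_pCons_Suc) (auto simp: char_poly_matrix_def)
  qed (use Ac in \<open>auto simp: char_poly_matrix_def\<close>)
  show ?thesis
  \<comment> \<open>For \<open>n = 0\<close> the rows \<open>0\<close> and \<open>n\<close>
    coincide, so the two-term expansion does not apply.\<close>
  proof (cases "n = 0")
    case True
    have "det A = A $$ (0,0)"
      using Ac True by (simp add: det_single)
    moreover have "char_poly (companion 0 q) = 1"
      unfolding char_poly_def by (rule det_dim_zero) simp
    ultimately show ?thesis
      unfolding char_poly_def A_def[symmetric] using A[of 0 0] True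
      by (simp add: char_poly_def)
  next
    case False
    have ut: "upper_triangular (mat_delete A 0 n)"
      using Ac by (auto simp: mat_delete_def A)
    have "diag_mat (mat_delete A 0 n) = replicate n (- 1)"
      using Ac by (intro nth_equalityI) (auto simp: diag_mat_def mat_delete_def A one_pCons)
    then have del_0: "det (mat_delete A 0 n) = (- 1) ^ n"
      using det_upper_triangular[OF ut mat_delete_carrier[OF Ac]]
      by (simp add: prod_list_replicate)
    have "det A = (\<Sum>i<Suc n. A $$ (i,n) * cofactor A i n)"
      by (rule laplace_expansion_column[OF Ac]) simp
    also have "\<dots> = (\<Sum>i\<in>{0,n}. A $$ (i,n) * cofactor A i n)"
      by (rule sum.mono_neutral_right) (auto simp: A)
    also have "\<dots> = [:a:] * cofactor A 0 n + [:0,1:] * cofactor A n n"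
      using False by (simp add: A)
    also have "\<dots> = [:a:] + [:0,1:] * char_poly (companion n q)"
      unfolding cofactor_def del_0 del_n char_poly_def
      by (simp flip: power_add power_mult_distrib)
    finally show ?thesis
      unfolding char_poly_def A_def[symmetric] by simp
  qed
qed

text \<open>Splitting off the constant coefficient is a Horner step; the recursion ends at the
  leading coefficient \<open>1\<close>, the characteristic polynomial of the empty matrix.\<close>

lemma char_poly_companion:
  assumes "degree p = n" "coeff p n = 1"
  shows "char_poly (companion n p) = p"
  using assms
proof (induction n arbitrary: p)
  case 0
  then have "p = 1"
    by (metis degree_eq_zeroE coeff_pCons_0 one_pCons)
  moreover have "char_poly (companion 0 p) = 1"
    unfolding char_poly_def by (rule det_dim_zero) simp
  ultimately show ?case by simp
next
  case (Suc n)
  obtain a q where p: "p = pCons a q" by (cases p)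
  with Suc.prems have "degree q = n" "coeff q n = 1"
    by (auto split: if_splits)
  with Suc.IH p show ?case
    by (simp add: char_poly_companion_pCons)
qed

section \<open>The Toeplitz matrix times powers of the companion matrix\<close>

lemma S_mat_carrier [simp]: "S_mat n p \<in> carrier_mat n n"
  by (simp add: S_mat_def)

lemma S_mat_index [simp]:
  "i < n \<Longrightarrow> j < n \<Longrightarrow> S_mat n p $$ (i,j) = (if i \<le> j then coeff p (n - (j - i)) else 0)"
  by (simp add: S_mat_def)

lemma dim_S_mat [simp]: "dim_row (S_mat n p) = n" "dim_col (S_mat n p) = n"
  by (simp_all add: S_mat_def)

text \<open>For \<open>p\<close> monic of degree \<open>n\<close>, read row \<open>i\<close> of
  \<open>X\<close> as the polynomial whose coefficient at \<open>x^(n-1-c)\<close> is the entry in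
  column \<open>c\<close>: the formula is multiplication by \<open>x\<close> modulo
  \<open>p\<close>.\<close>

lemma mult_companion_index:
  assumes X: "X \<in> carrier_mat n n" and "i < n" "c < n"
  shows "(X * companion n p) $$ (i,c) =
     - X $$ (i,0) * coeff p (n - 1 - c) + (if c + 1 < n then X $$ (i,c+1) else 0)"
proof -
  have "(X * companion n p) $$ (i,c) = (\<Sum>l<n. X $$ (i,l) * companion n p $$ (l,c))"
    using assms by (auto simp: scalar_prod_def atLeast0LessThan intro!: sum.cong)
  also have "\<dots> = (\<Sum>l<n. (if l = 0 then - X $$ (i,0) * coeff p (n - 1 - c) else 0)
      + (if l = c + 1 then X $$ (i,c+1) else 0))"
    using assms by (intro sum.cong) auto
  also have "\<dots> = - X $$ (i,0) * coeff p (n - 1 - c) + (if c + 1 < n then X $$ (i,c+1) else 0)"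
    using assms by (simp add: sum.distrib sum.delta)
  finally show ?thesis .
qed

text \<open>Row \<open>i\<close> is shifted to the left until its leading \<open>1\<close> reaches column \<open>0\<close> (at \<open>m = i\<close>);
  the next factor then replaces it by the negative of the remaining coefficients.\<close>

lemma S_mat_mult_companion_pow:
  assumes "coeff p n = 1" "m \<le> n" "i < n" "c < n"
  shows "(S_mat n p * companion n p ^\<^sub>m m) $$ (i,c) =
     (if m \<le> i then (if i \<le> c + m \<and> c + m < n then coeff p (n + i - c - m) else 0)
      else (if n \<le> c + m \<and> c + m \<le> n + i then - coeff p (n + i - c - m) else 0))"
  using assms(2-)
proof (induction m arbitrary: c)
  case 0
  then show ?case by auto
next
  case (Suc m)
  let ?R = "companion n p"
  have X: "S_mat n p * ?R ^\<^sub>m m \<in> carrier_mat n n"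
    by (intro mult_carrier_mat[of _ n n] pow_carrier_mat) auto
  have "S_mat n p * ?R ^\<^sub>m Suc m = (S_mat n p * ?R ^\<^sub>m m) * ?R"
    using assoc_mult_mat[OF S_mat_carrier pow_carrier_mat[OF companion_carrier] companion_carrier]
    by simp
  then have eq: "(S_mat n p * ?R ^\<^sub>m Suc m) $$ (i,c) =
     - (S_mat n p * ?R ^\<^sub>m m) $$ (i,0) * coeff p (n - 1 - c)
     + (if c + 1 < n then (S_mat n p * ?R ^\<^sub>m m) $$ (i,c+1) else 0)"
    using mult_companion_index[OF X] Suc.prems by simp
  have IH0: "(S_mat n p * ?R ^\<^sub>m m) $$ (i,0) = (if m = i then 1 else 0)"
    using Suc assms(1) by auto
  have IH1: "(S_mat n p * ?R ^\<^sub>m m) $$ (i,c+1) =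
     (if m \<le> i then (if i \<le> c + 1 + m \<and> c + 1 + m < n then coeff p (n + i - (c+1) - m) else 0)
      else (if n \<le> c + 1 + m \<and> c + 1 + m \<le> n + i then - coeff p (n + i - (c+1) - m) else 0))"
    if "c + 1 < n"
    using Suc that by simp
  consider "m < i" | "m = i" | "i < m" by linarith
  then show ?case
  proof cases
    case 1
    then show ?thesis unfolding eq IH0 using IH1 by auto
  next
    case 2
    have "n + i - (c+1) - m = n - 1 - c" using 2 by simp
    then show ?thesis unfolding eq IH0 using IH1 2 Suc.prems by auto
  next
    case 3
    then show ?thesis unfolding eq IH0 using IH1 by auto
  qed
qed

text \<open>At exponent \<open>n\<close> every row has passed its leading \<open>1\<close>, so row
  \<open>i\<close> is \<open>-p_i, ..., -p_0, 0, ..., 0\<close>. The symmetry of the coefficients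
  turns this into \<open>s\<close> times column \<open>i\<close> of the Toeplitz matrix.\<close>

lemma S_mat_mult_companion_pow_n:
  assumes "coeff p n = 1" and pal: "\<And>d. d \<le> n \<Longrightarrow> coeff p d = - (s * coeff p (n - d))"
  shows "S_mat n p * companion n p ^\<^sub>m n = s \<cdot>\<^sub>m transpose_mat (S_mat n p)"
proof (rule eq_matI)
  fix i j assume "i < dim_row (s \<cdot>\<^sub>m transpose_mat (S_mat n p))"
    "j < dim_col (s \<cdot>\<^sub>m transpose_mat (S_mat n p))"
  then have ij: "i < n" "j < n" by auto
  have "(S_mat n p * companion n p ^\<^sub>m n) $$ (i, j) = (if j \<le> i then - coeff p (i - j) else 0)"
    unfolding S_mat_mult_companion_pow[OF assms(1) order_refl ij] using ij by auto
  then show "(S_mat n p * companion n p ^\<^sub>m n) $$ (i, j) = (s \<cdot>\<^sub>m transpose_mat (S_mat n p)) $$ (i, j)"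
    using ij pal[of "i - j"] by (simp del: index_mult_mat(1))
qed auto

section \<open>Inverses and the monodromy identity\<close>

lemma mat_inverse_of_det_nonzero:
  fixes A :: "'a :: field mat"
  assumes A: "A \<in> carrier_mat n n" and "det A \<noteq> 0"
  shows "the (mat_inverse A) \<in> carrier_mat n n"
    "the (mat_inverse A) * A = 1\<^sub>m n" "A * the (mat_inverse A) = 1\<^sub>m n"
proof -
  obtain B where "mat_inverse A = Some B"
    using mat_inverse(1)[OF A, of "()"] det_non_zero_imp_unit[OF A assms(2), of "()"]
    by (cases "mat_inverse A") auto
  with mat_inverse(2)[OF A this]
  show "the (mat_inverse A) \<in> carrier_mat n n"
    "the (mat_inverse A) * A = 1\<^sub>m n" "A * the (mat_inverse A) = 1\<^sub>m n" by auto
qed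

lemma invertible_mat_of_det_nonzero:
  fixes A :: "'a :: field mat"
  assumes A: "A \<in> carrier_mat n n" and "det A \<noteq> 0"
  shows "invertible_mat A"
  unfolding invertible_mat_def inverts_mat_def
  using A mat_inverse_of_det_nonzero[OF assms]
  by (metis carrier_matD square_mat.simps)

lemma upper_triangular_S_mat: "upper_triangular (S_mat n p)"
  by auto

lemma det_S_mat: "coeff p n = 1 \<Longrightarrow> det (S_mat n p) = 1"
proof -
  assume "coeff p n = 1"
  then have "diag_mat (S_mat n p) = replicate n 1"
    by (intro nth_equalityI) (auto simp: diag_mat_def)
  then show ?thesis
    by (simp add: det_upper_triangular[OF upper_triangular_S_mat S_mat_carrier])
qed

lemma monodromy_S_mat:
  assumes "coeff p n = 1" and "\<And>d. d \<le> n \<Longrightarrow> coeff p d = - (s * coeff p (n - d))"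
  shows "s \<cdot>\<^sub>m (the (mat_inverse (S_mat n p)) * transpose_mat (S_mat n p)) = companion n p ^\<^sub>m n"
proof -
  let ?S = "S_mat n p" and ?T = "the (mat_inverse (S_mat n p))" and ?R = "companion n p"
  have T: "?T \<in> carrier_mat n n" "?T * ?S = 1\<^sub>m n"
    using mat_inverse_of_det_nonzero[of ?S n] det_S_mat[OF assms(1)] by auto
  have Rn: "?R ^\<^sub>m n \<in> carrier_mat n n" by (intro pow_carrier_mat) simp
  have "s \<cdot>\<^sub>m (?T * transpose_mat ?S) = ?T * (s \<cdot>\<^sub>m transpose_mat ?S)"
    by (rule mult_smult_distrib[OF T(1), symmetric]) auto
  also have "\<dots> = ?T * (?S * ?R ^\<^sub>m n)"
    using S_mat_mult_companion_pow_n[OF assms] by simp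
  also have "\<dots> = (?T * ?S) * ?R ^\<^sub>m n"
    using assoc_mult_mat[OF T(1) S_mat_carrier Rn] by simp
  also have "\<dots> = ?R ^\<^sub>m n"
    using T Rn by simp
  finally show ?thesis .
qed

section \<open>Eigenvalues of triangular matrices and of matrix powers\<close>

lemma upper_triangular_pow:
  fixes A :: "'a :: comm_ring_1 mat"
  assumes A: "A \<in> carrier_mat n n" and ut: "upper_triangular A"
  shows "upper_triangular (A ^\<^sub>m m) \<and> (\<forall>i<n. (A ^\<^sub>m m) $$ (i,i) = (A $$ (i,i)) ^ m)"
proof (induction m)
  case 0
  then show ?case using A by auto
next
  case (Suc m)
  let ?P = "A ^\<^sub>m m"
  have P: "?P \<in> carrier_mat n n" using A by simp
  have prod: "(?P * A) $$ (i,j) = (\<Sum>l<n. ?P $$ (i,l) * A $$ (l,j))" if "i < n" "j < n" for i j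
    using that A P by (auto simp: scalar_prod_def atLeast0LessThan intro!: sum.cong)
  have P0: "?P $$ (i,j) = 0" if "j < i" "i < n" for i j
    using Suc that P by (auto dest: upper_triangularD)
  have A0: "A $$ (i,j) = 0" if "j < i" "i < n" for i j
    using ut that A by (auto dest: upper_triangularD)
  have "(?P * A) $$ (i,j) = 0" if "j < i" "i < n" for i j
    unfolding prod[OF that(2) less_trans[OF that]]
  proof (intro sum.neutral ballI)
    fix l assume "l \<in> {..<n}"
    then show "?P $$ (i,l) * A $$ (l,j) = 0"
      using P0[of l i] A0[of j l] that by (cases "l < i") auto
  qed
  moreover have "(?P * A) $$ (i,i) = A $$ (i,i) ^ Suc m" if "i < n" for i
  proof -
    have "(?P * A) $$ (i,i) = (\<Sum>l<n. if l = i then ?P $$ (i,i) * A $$ (i,i) else 0)"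
      unfolding prod[OF that that]
    proof (rule sum.cong[OF refl])
      fix l assume "l \<in> {..<n}"
      then show "?P $$ (i,l) * A $$ (l,i) = (if l = i then ?P $$ (i,i) * A $$ (i,i) else 0)"
        using P0[of l i] A0[of i l] that by (cases l i rule: linorder_cases) auto
    qed
    then show ?thesis using that Suc by simp
  qed
  ultimately show ?case using A P by auto
qed

lemma eigenvalue_upper_triangular:
  fixes A :: "'a :: field mat"
  assumes A: "A \<in> carrier_mat n n" and ut: "upper_triangular A"
  shows "eigenvalue A \<mu> \<longleftrightarrow> (\<exists>i<n. \<mu> = A $$ (i,i))"
proof -
  have "poly (char_poly A) \<mu> = 0 \<longleftrightarrow> (\<exists>i<n. \<mu> = A $$ (i,i))"
    using A unfolding char_poly_upper_triangular[OF A ut] poly_prod_list prod_list_zero_iff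
    by (auto simp: diag_mat_def)
  then show ?thesis using eigenvalue_root_char_poly[OF A] by simp
qed

lemma eigenvalue_similar:
  fixes A :: "'a :: field mat"
  assumes "A \<in> carrier_mat n n" "B \<in> carrier_mat n n" "similar_mat A B"
  shows "eigenvalue A \<mu> \<longleftrightarrow> eigenvalue B \<mu>"
  using assms char_poly_similar eigenvalue_root_char_poly by metis

lemma smult_mat_mult_vec:
  fixes A :: "'a :: comm_ring_1 mat"
  assumes "A \<in> carrier_mat m n" "v \<in> carrier_vec n"
  shows "(c \<cdot>\<^sub>m A) *\<^sub>v v = c \<cdot>\<^sub>v (A *\<^sub>v v)"
  using assms by (intro eq_vecI) (auto simp: scalar_prod_def sum_distrib_left mult.assoc)

text \<open>A Schur form replaces \<open>A\<close> by a similar triangular matrix, whose powers have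
  the powers of its diagonal entries on the diagonal.\<close>

lemma eigenvalue_pow_mat:
  fixes A :: "complex mat"
  assumes A: "A \<in> carrier_mat n n" and "eigenvalue (A ^\<^sub>m m) \<mu>"
  shows "\<exists>\<nu>. eigenvalue A \<nu> \<and> \<mu> = \<nu> ^ m"
proof -
  obtain as where "char_poly A = (\<Prod>a\<leftarrow>as. [:- a, 1:])"
    using char_poly_factorized[OF A] by blast
  then obtain B where B: "B \<in> carrier_mat n n" "upper_triangular B" "similar_mat A B"
    using schur_decomposition_exists[OF A] by blast
  have "similar_mat (A ^\<^sub>m m) (B ^\<^sub>m m)"
    using B(3) similar_mat_wit_pow unfolding similar_mat_def by blast
  then have "eigenvalue (B ^\<^sub>m m) \<mu>"
    using assms(2) eigenvalue_similar[OF pow_carrier_mat[OF A] pow_carrier_mat[OF B(1)]] by blast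
  then obtain i where "i < n" "\<mu> = (B ^\<^sub>m m) $$ (i,i)"
    using eigenvalue_upper_triangular[OF pow_carrier_mat[OF B(1)]] upper_triangular_pow[OF B(1,2)]
    by blast
  then show ?thesis
    using upper_triangular_pow[OF B(1,2)] eigenvalue_upper_triangular[OF B(1,2)]
      eigenvalue_similar[OF A B(1,3)] by auto
qed

section \<open>One-dimensional eigenspaces, regularity and semisimplicity\<close>

text \<open>The kernel is the span of \<open>v\<close>. The vector \<open>v\<close> may be zero, so
  that a trivial kernel is covered as well.\<close>

lemma kernel_dim_le_1:
  fixes A :: "'a :: field mat"
  assumes A: "A \<in> carrier_mat n n" and v: "v \<in> mat_kernel A"
    and multiple: "\<And>w. w \<in> mat_kernel A \<Longrightarrow> \<exists>c. w = c \<cdot>\<^sub>v v"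
  shows "kernel_dim A \<le> 1"
proof -
  interpret kernel n n A by unfold_locales (rule A)
  have "span {v} = mat_kernel A"
  proof
    show "span {v} \<subseteq> mat_kernel A"
      using Ker.span_is_subset2[of "{v}"] v by auto
    show "mat_kernel A \<subseteq> span {v}"
    proof
      fix w assume "w \<in> mat_kernel A"
      then obtain c where w: "w = c \<cdot>\<^sub>v v" using multiple by blast
      have "v \<in> span {v}" using Ker.in_own_span[of "{v}"] v by auto
      then show "w \<in> span {v}"
        using submodule.smult_closed[OF Ker.span_is_submodule[of "{v}"], of c v] v w by auto
    qed
  qed
  then have "dim \<le> 1" using v by (intro Ker.dim_le1I) auto
  then show ?thesis by simp
qed

text \<open>For a list of Jordan blocks the filtered length is the number of blocks with eigenvalue
  \<open>e\<close>, the form in which geometric multiplicities arise below.\<close>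

lemma distinct_map_snd_if_filter:
  assumes "\<And>e. length (filter (\<lambda>(m, a). a = e) xs) \<le> 1"
  shows "distinct (map snd xs)"
  using assms
proof (induction xs)
  case (Cons x xs)
  have "length (filter (\<lambda>(m, a). a = e) xs) \<le> 1" for e
    using Cons.prems[of e] by (auto split: if_splits prod.splits)
  moreover have "filter (\<lambda>(m, a). a = snd x) xs = []"
    using Cons.prems[of "snd x"] by (auto split: prod.splits)
  then have "snd x \<notin> snd ` set xs"
    by (auto simp: filter_empty_conv)
  ultimately show ?case using Cons.IH by simp
qed simp

text \<open>Every Jordan block, being of positive size, contributes exactly one dimension to the
  eigenspace of its eigenvalue.\<close>

lemma distinct_jordan_eigenvalues:
  fixes A :: "complex mat"
  assumes "jordan_nf A n_as" and "\<And>e. dim_gen_eigenspace A e 1 \<le> 1"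
  shows "distinct (map snd n_as)"
proof (rule distinct_map_snd_if_filter)
  fix e
  have nz: "0 \<notin> fst ` set n_as" using assms(1) by (simp add: jordan_nf_def)
  have "(\<Sum>m\<leftarrow>map fst xs. min 1 m) = length xs" if "0 \<notin> fst ` set xs" for xs :: "(nat \<times> complex) list"
    using that by (induction xs) (auto simp: min_def)
  then have "dim_gen_eigenspace A e 1 = length (filter (\<lambda>(m, a). a = e) n_as)"
    unfolding dim_gen_eigenspace[OF assms(1)] using nz by force
  then show "length (filter (\<lambda>(m, a). a = e) n_as) \<le> 1"
    using assms(2) by metis
qed

lemma jordan_matrix_ones:
  fixes as :: "'a :: {zero,one} list"
  shows "jordan_matrix (map (Pair 1) as) =
    Matrix.mat (length as) (length as) (\<lambda>(i,j). if i = j then as ! i else 0)"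
proof (induction as)
  case Nil
  then show ?case by (auto simp: jordan_matrix_def)
next
  case (Cons a as)
  have len: "sum_list (map fst (map (Pair 1) as)) = length as"
    by (induction as) auto
  show ?case
    unfolding list.map jordan_matrix_Cons Cons.IH len
    by (rule eq_matI) (auto simp: nth_Cons' less_Suc_eq_0_disj split: if_splits)
qed

text \<open>A diagonal form is a Jordan form with blocks of size \<open>1\<close>, so small
  eigenspaces make its diagonal entries distinct. Conversely \<open>n\<close> distinct eigenvalues
  need at least \<open>n\<close> blocks; as the sizes are positive and add up to \<open>n\<close>,
  all of them are \<open>1\<close>.\<close>

lemma semisimple_iff_distinct_eigenvalues:
  assumes A: "A \<in> carrier_mat n n" and dim: "\<And>e. dim_gen_eigenspace A e 1 \<le> 1"
  shows "semisimple_mat A \<longleftrightarrow> distinct_eigenvalues n A"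
proof
  assume "semisimple_mat A"
  then obtain D where D: "diagonal_mat D" "similar_mat A D"
    by (auto simp: semisimple_mat_def)
  have Dc: "D \<in> carrier_mat n n"
    using similar_matD[OF D(2)] A by auto
  define as where "as = map (\<lambda>i. D $$ (i,i)) [0..<n]"
  have "jordan_matrix (map (Pair 1) as) = D"
    unfolding jordan_matrix_ones as_def
    using D(1) Dc by (intro eq_matI) (auto simp: diagonal_mat_def)
  then have "jordan_nf A (map (Pair 1) as)"
    using D(2) by (auto simp: jordan_nf_def)
  from distinct_jordan_eigenvalues[OF this dim] have "distinct as"
    by (simp add: comp_def)
  moreover have "{\<mu>. eigenvalue A \<mu>} = set as"
    using D(1) Dc unfolding eigenvalue_similar[OF A Dc D(2)] as_def
    by (subst eigenvalue_upper_triangular[OF Dc]) (auto simp: diagonal_mat_def)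
  moreover have "length as = n" by (simp add: as_def)
  ultimately show "distinct_eigenvalues n A"
    by (simp add: distinct_eigenvalues_def distinct_card)
next
  assume dist: "distinct_eigenvalues n A"
  obtain as where "char_poly A = (\<Prod>a\<leftarrow>as. [:- a, 1:])"
    using char_poly_factorized[OF A] by blast
  then obtain n_as where jnf: "jordan_nf A n_as"
    using jordan_nf_exists[OF A] by blast
  have sum: "sum_list (map fst n_as) = n"
    using jnf A similar_matD[of A "jordan_matrix n_as"] unfolding jordan_nf_def by force
  have nz: "0 \<notin> fst ` set n_as" using jnf by (simp add: jordan_nf_def)
  have "{\<mu>. eigenvalue A \<mu>} \<subseteq> set (map snd n_as)"
    unfolding eigenvalue_root_char_poly[OF A] jordan_nf_char_poly[OF jnf]
    by (force simp: poly_prod_list prod_list_zero_iff)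
  then have "n \<le> length n_as"
    using dist card_mono[of "set (map snd n_as)" "{\<mu>. eigenvalue A \<mu>}"] card_length[of "map snd n_as"]
    by (simp add: distinct_eigenvalues_def)
  moreover have "x = map (Pair 1) (map snd x)"
    if "0 \<notin> fst ` set x" "sum_list (map fst x) \<le> length x" for x :: "(nat \<times> complex) list"
    using that
  proof (induction x)
    case (Cons y ys)
    have "length ys \<le> sum_list (map fst ys)"
      using Cons.prems(1) by (induction ys) (auto simp: Suc_le_eq)
    then show ?case using Cons by (cases y) auto
  qed simp
  ultimately have "n_as = map (Pair 1) (map snd n_as)"
    using nz sum by blast
  then have "jordan_matrix n_as = jordan_matrix (map (Pair 1) (map snd n_as))"
    by (rule arg_cong)
  then have "diagonal_mat (jordan_matrix n_as)"
    unfolding jordan_matrix_ones by (simp add: diagonal_mat_def)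
  then show "semisimple_mat A"
    using jnf by (auto simp: semisimple_mat_def jordan_nf_def)
qed

lemma regular_mat_of_eigenspaces:
  assumes A: "A \<in> carrier_mat n n" and dim: "\<And>e. dim_gen_eigenspace A e 1 \<le> 1"
  shows "regular_mat A"
proof -
  obtain as where "char_poly A = (\<Prod>a\<leftarrow>as. [:- a, 1:])"
    using char_poly_factorized[OF A] by blast
  then obtain n_as where jnf: "jordan_nf A n_as"
    using jordan_nf_exists[OF A] by blast
  with distinct_jordan_eigenvalues[OF jnf dim] show ?thesis
    unfolding regular_mat_def by blast
qed

text \<open>Below the first row the eigenvalue equation reads \<open>v_j = e * v_(j+1)\<close>, so
  an eigenvector is determined by its last coordinate.\<close>

lemma dim_eigenspace_companion: "dim_gen_eigenspace (cmat (companion n p)) e 1 \<le> 1"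
proof -
  let ?R = "cmat (companion n p)"
  let ?C = "char_matrix ?R e"
  have C: "?C \<in> carrier_mat n n" by simp
  have "kernel_dim ?C \<le> 1"
  proof (cases "mat_kernel ?C \<subseteq> {0\<^sub>v n}")
    case True
    have "0\<^sub>v n \<in> mat_kernel ?C"
      by (rule mat_kernelI[OF C])
        (auto intro!: eq_vecI simp: carrier_matD[OF C] scalar_prod_def)
    then show ?thesis
      using True by (intro kernel_dim_le_1[OF C, of "0\<^sub>v n"]) (auto intro!: exI[of _ 0] eq_vecI)
  next
    case False
    have coord: "vec_index v i = e ^ (n - 1 - i) * vec_index v (n - 1)"
      if v: "v \<in> mat_kernel ?C" and i: "i < n" for v i
    proof -
      have vc: "v \<in> carrier_vec n" and Cv: "?C *\<^sub>v v = 0\<^sub>v n"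
        using mat_kernelD[OF C v] by auto
      have step: "vec_index v j = e * vec_index v (Suc j)" if "Suc j < n" for j
      proof -
        have "0 = vec_index (?C *\<^sub>v v) (Suc j)"
          using Cv that by simp
        also have "\<dots> = (\<Sum>l<n. ?C $$ (Suc j, l) * vec_index v l)"
          using that vc by (auto simp: scalar_prod_def atLeast0LessThan char_matrix_def intro!: sum.cong)
        also have "\<dots> = (\<Sum>l<n. (if l = j then vec_index v j else 0)
            + (if l = Suc j then - e * vec_index v (Suc j) else 0))"
          using that by (intro sum.cong) (auto simp: char_matrix_def)
        also have "\<dots> = vec_index v j - e * vec_index v (Suc j)"
          using that by (simp add: sum.distrib)
        finally show ?thesis by simp
      qed
      have "m < n \<Longrightarrow> vec_index v (n - 1 - m) = e ^ m * vec_index v (n - 1)" for m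
      proof (induction m)
        case (Suc m)
        have "Suc (n - 1 - Suc m) = n - 1 - m" using Suc.prems by simp
        with step[of "n - 1 - Suc m"] Suc show ?case by simp
      qed simp
      from this[of "n - 1 - i"] i show ?thesis by simp
    qed
    obtain v where v: "v \<in> mat_kernel ?C" "v \<noteq> 0\<^sub>v n" using False by blast
    have vc: "v \<in> carrier_vec n" using mat_kernelD[OF C v(1)] by auto
    have nz: "vec_index v (n - 1) \<noteq> 0"
    proof
      assume "vec_index v (n - 1) = 0"
      then have "v = 0\<^sub>v n" using vc coord[OF v(1)] by (intro eq_vecI) auto
      with v(2) show False by blast
    qed
    show ?thesis
    proof (rule kernel_dim_le_1[OF C v(1)])
      fix w assume w: "w \<in> mat_kernel ?C"
      have wc: "w \<in> carrier_vec n" using mat_kernelD[OF C w] by auto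
      have "w = (vec_index w (n - 1) / vec_index v (n - 1)) \<cdot>\<^sub>v v"
      proof (rule eq_vecI)
        fix i assume "i < dim_vec ((vec_index w (n - 1) / vec_index v (n - 1)) \<cdot>\<^sub>v v)"
        then have i: "i < n" using vc by simp
        show "vec_index w i = vec_index ((vec_index w (n - 1) / vec_index v (n - 1)) \<cdot>\<^sub>v v) i"
          using i vc nz coord[OF w i] coord[OF v(1) i] by simp
      qed (use vc wc in simp)
      then show "\<exists>c. w = c \<cdot>\<^sub>v v" by blast
    qed
  qed
  then show ?thesis by (simp add: dim_gen_eigenspace_def)
qed

section \<open>Eigenvalue families and membership in \<open>T_mat\<close>\<close>

lemma eigenvalue_iff_of_has_eigenvalues:
  assumes "A \<in> carrier_mat n n" "has_eigenvalues n A ev"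
  shows "eigenvalue A \<mu> \<longleftrightarrow> \<mu> \<in> ev ` {1..n}"
  using assms unfolding eigenvalue_root_char_poly[OF assms(1)] has_eigenvalues_def
  by (auto simp: poly_prod prod_zero_iff image_iff)

lemma distinct_eigenvalues_iff_inj:
  assumes "A \<in> carrier_mat n n" "has_eigenvalues n A ev"
  shows "distinct_eigenvalues n A \<longleftrightarrow> inj_on ev {1..n}"
proof -
  have "{\<mu>. eigenvalue A \<mu>} = ev ` {1..n}"
    using eigenvalue_iff_of_has_eigenvalues[OF assms] by auto
  then show ?thesis
    unfolding distinct_eigenvalues_def inj_on_iff_eq_card[OF finite_atLeastAtMost] by simp
qed

lemma has_eigenvalues_companion:
  assumes "degree p = n" "coeff p n = 1"
    "map_poly complex_of_real p = (\<Prod>j=1..n. [:- ev j, 1:])"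
  shows "has_eigenvalues n (cmat (companion n p)) ev"
  using of_real_hom.char_poly_hom[OF companion_carrier[of n p], where 'a = complex] assms
  by (simp add: has_eigenvalues_def char_poly_companion)

text \<open>The determinant is nonzero because \<open>0\<close> is not an eigenvalue: it is not a
  root of the characteristic polynomial \<open>p\<close>.\<close>

lemma invertible_companion:
  assumes "degree p = n" "coeff p n = 1" "coeff p 0 \<noteq> 0"
  shows "invertible_mat (companion n p)"
proof (rule invertible_mat_of_det_nonzero[OF companion_carrier])
  have "char_matrix (companion n p) 0 = companion n p"
    by (intro eq_matI) (auto simp: char_matrix_def)
  then show "det (companion n p) \<noteq> 0"
    using eigenvalue_det[OF companion_carrier[of n p], of 0]
      eigenvalue_root_char_poly[OF companion_carrier[of n p], of 0] assms
    by (simp add: char_poly_companion poly_0_coeff_0)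
qed

text \<open>By the monodromy identity an eigenvalue \<open>\<mu>\<close> of \<open>?M\<close> makes
  \<open>s * \<mu>\<close> an eigenvalue of the \<open>n\<close>-th power of the companion matrix,
  hence the \<open>n\<close>-th power of a number of norm \<open>1\<close>; and \<open>s\<close> is
  a sign.\<close>

lemma S_mat_in_T_mat:
  assumes "degree p = n" "coeff p n = 1" "s \<in> {1, -1}"
    and pal: "\<And>d. d \<le> n \<Longrightarrow> coeff p d = - (s * coeff p (n - d))"
    and roots: "\<And>\<mu>. eigenvalue (cmat (companion n p)) \<mu> \<Longrightarrow> norm \<mu> = 1"
  shows "S_mat n p \<in> T_mat n"
proof -
  let ?M = "the (mat_inverse (S_mat n p)) * transpose_mat (S_mat n p)" and ?R = "companion n p"
  have M: "?M \<in> carrier_mat n n"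
    using mat_inverse_of_det_nonzero(1)[of "S_mat n p" n] det_S_mat[OF assms(2)]
    by (intro mult_carrier_mat[of _ n n]) auto
  have "norm \<mu> = 1" if ev: "eigenvalue (cmat ?M) \<mu>" for \<mu>
  proof -
    obtain v where v: "v \<in> carrier_vec n" "v \<noteq> 0\<^sub>v n" "cmat ?M *\<^sub>v v = \<mu> \<cdot>\<^sub>v v"
      using ev M by (auto simp: eigenvalue_def eigenvector_def)
    have "cmat ?R ^\<^sub>m n = cmat (?R ^\<^sub>m n)"
      by (rule of_real_hom.mat_hom_pow[OF companion_carrier, symmetric])
    also have "\<dots> = cmat (s \<cdot>\<^sub>m ?M)"
      using monodromy_S_mat[OF assms(2) pal] by simp
    also have "\<dots> = of_real s \<cdot>\<^sub>m cmat ?M"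
      by (intro eq_matI) auto
    finally have "cmat ?R ^\<^sub>m n *\<^sub>v v = (of_real s * \<mu>) \<cdot>\<^sub>v v"
      using v M by (simp add: smult_mat_mult_vec smult_smult_assoc)
    moreover have "cmat ?R ^\<^sub>m n \<in> carrier_mat n n" by (intro pow_carrier_mat) simp
    ultimately have "eigenvalue (cmat ?R ^\<^sub>m n) (of_real s * \<mu>)"
      using v unfolding eigenvalue_def eigenvector_def by auto
    then obtain \<nu> where "eigenvalue (cmat ?R) \<nu>" "of_real s * \<mu> = \<nu> ^ n"
      using eigenvalue_pow_mat[of "cmat ?R" n] by auto
    then have "norm (of_real s * \<mu>) = 1"
      using roots by (simp add: norm_power)
    then show ?thesis using assms(3) by (auto simp: norm_mult)
  qed
  then show ?thesis
    using assms(2) upper_triangular_S_mat[of n p] by (auto simp: T_mat_def)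
qed

section \<open>The parameter simplex\<close>

lemma sum_fun_apply: "(\<Sum>i\<in>I. f i) x = (\<Sum>i\<in>I. f i x)"
  for f :: "'i \<Rightarrow> 'a \<Rightarrow> 'b::comm_monoid_add"
  by (induction I rule: infinite_finite_induct) auto

lemma scaleR_fun_apply [simp]: "(c *\<^sub>R f) x = c *\<^sub>R f x"
  by (simp add: scaleR_fun_def)

definition half_simplex :: "nat \<Rightarrow> (nat \<Rightarrow> real) set" where
  "half_simplex m =
     {x \<in> coord_space m. (\<forall>j\<in>{1..m}. 0 \<le> x j \<and> x j \<le> 1/2) \<and> mono_on {1..m} x}"

text \<open>The index \<open>i\<close> counts the zeros before the jump to \<open>1/2\<close>:
  \<open>i = 0\<close> is the constant sequence on \<open>{1..m}\<close>, \<open>i = m\<close> is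
  the origin.\<close>

definition half_vertex :: "nat \<Rightarrow> nat \<Rightarrow> nat \<Rightarrow> real" where
  "half_vertex m i = (\<lambda>j. if i < j \<and> j \<le> m then 1/2 else 0)"

lemma half_vertex_mem: "half_vertex m i \<in> half_simplex m"
  by (auto simp: half_simplex_def half_vertex_def coord_space_def mono_on_def)

lemma inj_on_half_vertex: "inj_on (half_vertex m) {..<Suc m}"
proof (rule linorder_inj_onI)
  fix i j assume "i < j" "j \<in> {..<Suc m}"
  then have "half_vertex m i j \<noteq> half_vertex m j j"
    by (simp add: half_vertex_def)
  then show "half_vertex m i \<noteq> half_vertex m j" by metis
qed auto

text \<open>Coordinate \<open>j\<close> only sees the vertices that jump before \<open>j\<close>, so
  coordinates are halved partial sums of the weights. Both the barycentric coordinates and affine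
  independence are read off from this.\<close>

lemma sum_half_vertex:
  assumes "j \<le> m"
  shows "(\<Sum>i<Suc m. u i *\<^sub>R half_vertex m i) j = (\<Sum>i<j. u i) / 2"
proof -
  have "(\<Sum>i<Suc m. u i *\<^sub>R half_vertex m i) j = (\<Sum>i<Suc m. if i < j then u i / 2 else 0)"
    unfolding sum_fun_apply using assms by (intro sum.cong) (auto simp: half_vertex_def)
  also have "\<dots> = (\<Sum>i<j. u i / 2)"
    using assms by (subst sum.inter_filter[symmetric]) (auto intro!: sum.cong)
  finally show ?thesis by (simp add: sum_divide_distrib)
qed

lemma convex_half_simplex: "convex (half_simplex m)"
proof (rule convexI)
  fix x y :: "nat \<Rightarrow> real" and u v :: real
  assume x: "x \<in> half_simplex m" and y: "y \<in> half_simplex m" and uv: "0 \<le> u" "0 \<le> v" "u + v = 1"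
  have "0 \<le> u * x j + v * y j \<and> u * x j + v * y j \<le> 1/2" if "j \<in> {1..m}" for j
  proof -
    have *: "0 \<le> x j" "x j \<le> 1/2" "0 \<le> y j" "y j \<le> 1/2"
      using x y that by (auto simp: half_simplex_def)
    have "u * x j + v * y j \<le> u * (1/2) + v * (1/2)"
      using * uv by (intro add_mono mult_left_mono) auto
    also have "\<dots> = 1/2" using uv by (simp add: field_simps)
    finally show ?thesis using * uv by simp
  qed
  moreover have "u * x i + v * y i \<le> u * x j + v * y j" if "i \<in> {1..m}" "j \<in> {1..m}" "i \<le> j" for i j
    using x y uv that by (intro add_mono mult_left_mono) (auto simp: half_simplex_def mono_on_def)
  ultimately show "u *\<^sub>R x + v *\<^sub>R y \<in> half_simplex m"
    using x y by (auto simp: half_simplex_def coord_space_def mono_on_def)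
qed

lemma convex_hull_half_vertex: "convex hull (half_vertex m ` {..<Suc m}) = half_simplex m"
proof
  show "convex hull (half_vertex m ` {..<Suc m}) \<subseteq> half_simplex m"
    by (intro hull_minimal convex_half_simplex) (auto simp: half_vertex_mem)
next
  show "half_simplex m \<subseteq> convex hull (half_vertex m ` {..<Suc m})"
  proof
    fix x assume x: "x \<in> half_simplex m"
    \<comment> \<open>Padding \<open>x\<close> by \<open>0\<close> in front and \<open>1/2\<close>
      behind makes the weights twice the consecutive gaps: nonnegative by monotonicity, with
      telescoping sum \<open>1\<close>.\<close>
    define y where "y j = (if j = 0 then 0 else if j \<le> m then x j else 1/2)" for j
    define u where "u i = 2 * (y (Suc i) - y i)" for i
    have sum_u: "(\<Sum>i<j. u i) = 2 * y j" for j
      unfolding u_def sum_distrib_left[symmetric] sum_lessThan_telescope by (simp add: y_def)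
    have "x = (\<Sum>i<Suc m. u i *\<^sub>R half_vertex m i)"
    proof
      fix j
      show "x j = (\<Sum>i<Suc m. u i *\<^sub>R half_vertex m i) j"
      proof (cases "j \<le> m")
        case True
        then show ?thesis
          unfolding sum_half_vertex[OF True] sum_u using x
          by (auto simp: y_def half_simplex_def coord_space_def)
      next
        case False
        then show ?thesis
          unfolding sum_fun_apply using x
          by (auto simp: half_vertex_def half_simplex_def coord_space_def)
      qed
    qed
    moreover have "u i \<ge> 0" if "i \<in> {..<Suc m}" for i
      using x that by (auto simp: u_def y_def half_simplex_def mono_on_def)
    moreover have "sum u {..<Suc m} = 1"
      unfolding sum_u by (simp add: y_def)
    ultimately show "x \<in> convex hull (half_vertex m ` {..<Suc m})"
      using convex_sum[of "{..<Suc m}" "convex hull (half_vertex m ` {..<Suc m})" u "half_vertex m"]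
      by (simp del: sum.lessThan_Suc add: hull_inc)
  qed
qed

text \<open>In a vanishing combination of total weight \<open>0\<close> all partial sums of the
  weights vanish, and each weight is a difference of two of them.\<close>

lemma affine_independent_half_vertex: "\<not> affine_dependent (half_vertex m ` {..<Suc m})"
proof
  assume "affine_dependent (half_vertex m ` {..<Suc m})"
  then obtain U where U: "sum U (half_vertex m ` {..<Suc m}) = 0"
      "\<exists>v\<in>half_vertex m ` {..<Suc m}. U v \<noteq> 0"
      "(\<Sum>v\<in>half_vertex m ` {..<Suc m}. U v *\<^sub>R v) = 0"
    by (auto simp: affine_dependent_explicit_finite)
  define u where "u i = U (half_vertex m i)" for i
  have sum_u: "(\<Sum>i<Suc m. u i) = 0" and lin_u: "(\<Sum>i<Suc m. u i *\<^sub>R half_vertex m i) = 0"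
    using U(1,3) by (simp_all add: sum.reindex[OF inj_on_half_vertex] u_def)
  have zero: "(\<Sum>i<j. u i) = 0" if "j \<le> Suc m" for j
  proof (cases "j \<le> m")
    case True
    from sum_half_vertex[OF this, of u] show ?thesis unfolding lin_u by simp
  next
    case False
    with that sum_u show ?thesis by (simp add: le_Suc_eq)
  qed
  have "u i = 0" if "i < Suc m" for i
    using zero[of i] zero[of "Suc i"] that by simp
  with U(2) show False by (auto simp: u_def)
qed

text \<open>The linear left inverse \<open>g\<close> carries an affine relation among the images
  back to one in \<open>C\<close>.\<close>

lemma affine_independent_linear_image:
  fixes f :: "'a::real_vector \<Rightarrow> 'b::real_vector"
  assumes "finite C" "\<not> affine_dependent C" "linear g" "\<And>x. x \<in> C \<Longrightarrow> g (f x) = x"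
  shows "\<not> affine_dependent (f ` C)"
proof
  assume "affine_dependent (f ` C)"
  then obtain U where U: "sum U (f ` C) = 0" "\<exists>v\<in>f ` C. U v \<noteq> 0" "(\<Sum>v\<in>f ` C. U v *\<^sub>R v) = 0"
    using assms(1) by (auto simp: affine_dependent_explicit_finite)
  have inj: "inj_on f C" using assms(4) by (metis inj_onI)
  have "0 = g (\<Sum>v\<in>f ` C. U v *\<^sub>R v)"
    using U(3) assms(3) by (simp add: linear_0)
  also have "\<dots> = (\<Sum>x\<in>C. U (f x) *\<^sub>R x)"
    using assms(3,4) by (simp add: linear_sum linear_cmul sum.reindex[OF inj])
  finally have "(\<Sum>x\<in>C. U (f x) *\<^sub>R x) = 0" ..
  moreover have "(\<Sum>x\<in>C. U (f x)) = 0" using U(1) by (simp add: sum.reindex[OF inj])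
  ultimately have "affine_dependent C"
    unfolding affine_dependent_explicit_finite[OF assms(1)] using U(2) 
    by (intro exI[of _ "U \<circ> f"]) auto
  with assms(2) show False by blast
qed

section \<open>Affine dimension\<close>

text \<open>Moving a point of each set to the origin reduces this to the bound of independent
  vectors by a finite spanning set. It makes the number in \<open>affine_dimension\<close>
  unique.\<close>

lemma affine_independent_card_le:
  fixes B C :: "'a::real_vector set"
  assumes "finite B" "finite C" "\<not> affine_dependent B" "affine hull B \<subseteq> affine hull C"
  shows "card B \<le> card C"
proof (cases "B = {}")
  case False
  then obtain a where a: "a \<in> B" by blast
  then have "C \<noteq> {}" using assms(4) hull_inc[of a B affine] by (auto simp: affine_hull_empty)
  then obtain c where c: "c \<in> C" by blast
  let ?T = "(+) (- c) ` (C - {c})"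
  have aff: "affine hull C = (+) c ` span ?T"
    using affine_hull_span2[OF c] by simp
  have "b - a \<in> span ?T" if "b \<in> B" for b
  proof -
    have "b \<in> affine hull C" "a \<in> affine hull C"
      using that a assms(4) hull_inc[of _ B affine] by blast+
    then obtain x y where "b = c + x" "a = c + y" "x \<in> span ?T" "y \<in> span ?T"
      unfolding aff by auto
    then show ?thesis by (simp add: span_diff)
  qed
  then have "(+) (- a) ` (B - {a}) \<subseteq> span ?T" by auto
  moreover have "independent ((+) (- a) ` (B - {a}))"
    using assms(3) affine_dependent_iff_dependent2[OF a] by blast
  ultimately have "card ((+) (- a) ` (B - {a})) \<le> card ?T"
    using independent_span_bound[of ?T] assms(2) by blast
  then have "card (B - {a}) \<le> card (C - {c})"
    by (simp add: card_image)
  then show ?thesis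
    using card.remove[OF assms(1) a] card.remove[OF assms(2) c] by simp
qed simp

lemma affine_dimension_eq:
  assumes "finite B" "affine hull B = affine hull V" "\<not> affine_dependent B" "card B = d + 1"
  shows "affine_dimension V = d"
  unfolding affine_dimension_def
proof (rule the_equality)
  show "\<exists>B. finite B \<and> affine hull B = affine hull V \<and> \<not> affine_dependent B \<and> card B = d + 1"
    using assms by blast
next
  fix e assume "\<exists>B. finite B \<and> affine hull B = affine hull V \<and> \<not> affine_dependent B \<and> card B = e + 1"
  then obtain C where "finite C" "affine hull C = affine hull V" "\<not> affine_dependent C" "card C = e + 1"
    by blast
  with affine_independent_card_le[of B C] affine_independent_card_le[of C B] assms
  show "e = d" by simp
qed

section \<open>Folding the parameters along their symmetry\<close>

text \<open>This treats both families at once: the symmetry is the reflection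
  \<open>j -> n + k - j\<close> of the index range \<open>{k..n}\<close>.\<close>

lemma T_scal_iff:
  assumes "k \<in> {1,2}"
  shows "\<beta> \<in> T_scal k n \<longleftrightarrow> \<beta> \<in> coord_space n \<and> (\<forall>j\<in>{1..n}. \<beta> j \<in> {0..1}) \<and>
     mono_on {1..n} \<beta> \<and> (k = 2 \<longrightarrow> \<beta> 1 = 0) \<and> (\<forall>j\<in>{k..n}. \<beta> j + \<beta> (n + k - j) = 1)"
  using assms by (auto simp: T_scal_def T_scal_HOR1_def T_scal_HOR2_def)

text \<open>The number of two-element orbits of the reflection \<open>j -> n + k - j\<close> on the
  \<open>n + 1 - k\<close> indices \<open>k..n\<close>.\<close>

definition half_dim :: "nat \<Rightarrow> nat \<Rightarrow> nat" where
  "half_dim k n = (n + 1 - k) div 2"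

text \<open>
  A point of the parameter set is determined by its entries \<open>\<beta>\<^sub>k, \<dots>, \<beta>\<^sub>k\<^sub>+\<^sub>m\<^sub>-\<^sub>1 \<in> [0,1/2]\<close>;
  the last \<open>m\<close> entries are their reflections, and a remaining middle entry is \<open>1/2\<close>.
\<close>

definition unfold_linear :: "nat \<Rightarrow> nat \<Rightarrow> (nat \<Rightarrow> real) \<Rightarrow> nat \<Rightarrow> real" where
  "unfold_linear k n x j =
     (if k \<le> j \<and> j < k + half_dim k n then x (j + 1 - k)
      else if n < j + half_dim k n \<and> j \<le> n then - x (n + 1 - j) else 0)"

definition unfold_const :: "nat \<Rightarrow> nat \<Rightarrow> nat \<Rightarrow> real" where
  "unfold_const k n j =
     (if n < j + half_dim k n \<and> j \<le> n then 1
      else if k + half_dim k n \<le> j \<and> j + half_dim k n \<le> n then 1/2 else 0)"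

definition fold_linear :: "nat \<Rightarrow> nat \<Rightarrow> (nat \<Rightarrow> real) \<Rightarrow> nat \<Rightarrow> real" where
  "fold_linear k n \<beta> j = (if 1 \<le> j \<and> j \<le> half_dim k n then \<beta> (j + k - 1) else 0)"

lemma linear_unfold_linear: "linear (unfold_linear k n)"
  by (rule linearI) (auto simp: unfold_linear_def fun_eq_iff)

lemma linear_fold_linear: "linear (fold_linear k n)"
  by (rule linearI) (auto simp: fold_linear_def fun_eq_iff)

text \<open>Together the bounds say that at most one index lies between the lower and the upper
  half.\<close>

lemma half_dim_le:
  assumes "n \<ge> 1" "k \<in> {1,2}"
  shows "k + 2 * half_dim k n \<le> n + 1" "n \<le> k + 2 * half_dim k n"
  using assms by (auto simp: half_dim_def)

text \<open>The constant part vanishes on the lower half, so folding undoes both the linear map and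
  the affine one; the former serves affine independence, the latter the bijection.\<close>

lemma fold_unfold:
  assumes "n \<ge> 1" "k \<in> {1,2}" "x \<in> coord_space (half_dim k n)"
  shows "fold_linear k n (unfold_linear k n x) = x"
    "fold_linear k n (unfold_const k n + unfold_linear k n x) = x"
  using half_dim_le[OF assms(1,2)] assms
  by (auto simp: fun_eq_iff fold_linear_def unfold_linear_def unfold_const_def coord_space_def)

lemma unfold_fold:
  assumes "n \<ge> 1" "k \<in> {1,2}" "\<beta> \<in> T_scal k n"
  shows "unfold_const k n + unfold_linear k n (fold_linear k n \<beta>) = \<beta>"
proof
  fix j
  note m = half_dim_le[OF assms(1,2)]
  have \<beta>: "\<beta> \<in> coord_space n" "k = 2 \<longrightarrow> \<beta> 1 = 0" "\<And>j. k \<le> j \<Longrightarrow> j \<le> n \<Longrightarrow> \<beta> j + \<beta> (n + k - j) = 1"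
    using assms(3) unfolding T_scal_iff[OF assms(2)] by auto
  \<comment> \<open>The ranges are: indices before the reflected block, lower half, possible middle
    index, upper half, indices beyond \<open>n\<close>.\<close>
  consider "j < k" | "k \<le> j" "j < k + half_dim k n" | "k + half_dim k n \<le> j" "j + half_dim k n \<le> n"
    | "n < j + half_dim k n" "j \<le> n" "k + half_dim k n \<le> j" | "n < j"
    by linarith
  then show "(unfold_const k n + unfold_linear k n (fold_linear k n \<beta>)) j = \<beta> j"
  proof cases
    case 1
    have "\<beta> j = 0"
      using 1 \<beta>(1,2) assms(2) by (cases "j = 0"; cases "j = 1") (auto simp: coord_space_def)
    moreover have "\<not> n < j + half_dim k n" using 1 m assms(1,2) by auto
    ultimately show ?thesis
      using 1 by (simp add: unfold_const_def unfold_linear_def)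
  next
    case 2
    then have "\<not> n < j + half_dim k n" "j + 1 - k + k - 1 = j" "1 \<le> j + 1 - k" "j + 1 - k \<le> half_dim k n"
      using m by auto
    with 2 show ?thesis
      by (simp add: unfold_const_def unfold_linear_def fold_linear_def)
  next
    case 3
    then have "n + k - j = j" using m by simp
    with \<beta>(3)[of j] 3 have "\<beta> j = 1/2" by simp
    with 3 show ?thesis
      by (simp add: unfold_const_def unfold_linear_def fold_linear_def)
  next
    case 4
    then have "n + 1 - j + k - 1 = n + k - j" "1 \<le> n + 1 - j" "n + 1 - j \<le> half_dim k n" 
      by auto
    with 4 \<beta>(3)[of j] show ?thesis
      by (simp add: unfold_const_def unfold_linear_def fold_linear_def)
  next
    case 5
    then have "\<beta> j = 0" using \<beta>(1) by (auto simp: coord_space_def)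
    moreover have "k + half_dim k n \<le> j" using 5 m assms(2) by auto
    ultimately show ?thesis
      using 5 by (simp add: unfold_const_def unfold_linear_def)
  qed
qed

lemma unfold_mem:
  assumes "n \<ge> 1" "k \<in> {1,2}" and x: "x \<in> half_simplex (half_dim k n)"
  shows "unfold_const k n + unfold_linear k n x \<in> T_scal k n"
proof -
  note m = half_dim_le[OF assms(1,2)]
  define \<beta> where "\<beta> = unfold_const k n + unfold_linear k n x"
  have x0: "0 \<le> x j" "x j \<le> 1/2" if "1 \<le> j" "j \<le> half_dim k n" for j
    using x that by (auto simp: half_simplex_def)
  have x1: "x j \<le> 1" if "1 \<le> j" "j \<le> half_dim k n" for j
    using x0(2)[OF that] by simp
  have xm: "x i \<le> x j" if "1 \<le> i" "i \<le> j" "j \<le> half_dim k n" for i j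
    using x that by (auto simp: half_simplex_def mono_on_def)
  have \<beta>: "\<beta> j = (if k \<le> j \<and> j < k + half_dim k n then x (j + 1 - k)
      else if n < j + half_dim k n \<and> j \<le> n then 1 - x (n + 1 - j)
      else if k + half_dim k n \<le> j \<and> j + half_dim k n \<le> n then 1/2 else 0)" for j
    using m by (auto simp: \<beta>_def unfold_const_def unfold_linear_def)
  have range: "0 \<le> \<beta> j" "\<beta> j \<le> 1" for j
    using x0(1)[of "j + 1 - k"] x0(1)[of "n + 1 - j"] x1[of "j + 1 - k"] x1[of "n + 1 - j"]
    unfolding \<beta> by auto
  have "\<beta> i \<le> \<beta> j" if "1 \<le> i" "i \<le> j" "j \<le> n" for i j
  proof -
    \<comment> \<open>Within a half monotonicity comes from \<open>x\<close>, reversed twice in the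
      upper one; between the halves the value \<open>1/2\<close> separates.\<close>
    consider "i < k" | "k \<le> i" "j < k + half_dim k n" | "k \<le> i" "i < k + half_dim k n" "k + half_dim k n \<le> j"
      | "k + half_dim k n \<le> i" "i + half_dim k n \<le> n" | "k + half_dim k n \<le> i" "n < i + half_dim k n"
      by linarith
    then show ?thesis
    proof cases
      case 1
      then have "\<beta> i = 0" using m that assms(1,2) unfolding \<beta> by auto
      then show ?thesis using range by simp
    next
      case 2
      then show ?thesis
        using that xm[of "i + 1 - k" "j + 1 - k"] unfolding \<beta> by auto
    next
      case 3
      then have "\<beta> i \<le> 1/2" using x0[of "i + 1 - k"] unfolding \<beta> by auto
      moreover have "1/2 \<le> \<beta> j" using 3 x0[of "n + 1 - j"] that unfolding \<beta> by auto
      ultimately show ?thesis by simp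
    next
      case 4
      then have "\<beta> i = 1/2" unfolding \<beta> by auto
      moreover have "1/2 \<le> \<beta> j" using 4 x0[of "n + 1 - j"] that unfolding \<beta> by auto
      ultimately show ?thesis by simp
    next
      case 5
      then show ?thesis
        using that xm[of "n + 1 - j" "n + 1 - i"] unfolding \<beta> by auto
    qed
  qed
  moreover have "\<beta> j + \<beta> (n + k - j) = 1" if j: "k \<le> j" "j \<le> n" for j
  proof -
    consider "j < k + half_dim k n" | "k + half_dim k n \<le> j" "j + half_dim k n \<le> n"
      | "k + half_dim k n \<le> j" "n < j + half_dim k n" by linarith
    then show ?thesis
    proof cases
      case 1
      then have "n + 1 - (n + k - j) = j + 1 - k" "\<not> n + k - j < k + half_dim k n"
        "n < n + k - j + half_dim k n" "n + k - j \<le> n"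
        using j m by auto
      then show ?thesis using 1 j unfolding \<beta> by simp
    next
      case 2
      then have "n + k - j = j" using m by simp
      then show ?thesis using 2 unfolding \<beta> by simp
    next
      case 3
      then have "n + k - j + 1 - k = n + 1 - j" "n + k - j < k + half_dim k n" "k \<le> n + k - j"
        using j by auto
      then show ?thesis using 3 j unfolding \<beta> by simp
    qed
  qed
  moreover have "\<beta> \<in> coord_space n" using m assms(2) unfolding coord_space_def \<beta> by auto
  moreover have "k = 2 \<longrightarrow> \<beta> 1 = 0" using m assms(1) unfolding \<beta> by auto
  ultimately show ?thesis
    using range unfolding T_scal_iff[OF assms(2)] \<beta>_def[symmetric] by (auto simp: mono_on_def)
qed

text \<open>A value in the lower half is at most its mirror value, and the two add up to
  \<open>1\<close>, so it is at most \<open>1/2\<close>.\<close>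

lemma fold_mem:
  assumes "n \<ge> 1" "k \<in> {1,2}" and \<beta>: "\<beta> \<in> T_scal k n"
  shows "fold_linear k n \<beta> \<in> half_simplex (half_dim k n)"
proof -
  note m = half_dim_le[OF assms(1,2)]
  have mono: "\<beta> i \<le> \<beta> j" if "1 \<le> i" "i \<le> j" "j \<le> n" for i j
    using \<beta> that unfolding T_scal_iff[OF assms(2)] by (auto simp: mono_on_def)
  have "0 \<le> \<beta> (j + k - 1)" "\<beta> (j + k - 1) \<le> 1/2" if j: "1 \<le> j" "j \<le> half_dim k n" for j
  proof -
    have r: "j + k - 1 \<in> {1..n}" "j + k - 1 \<in> {k..n}" using j m assms(2) by auto
    then show "0 \<le> \<beta> (j + k - 1)" using \<beta> unfolding T_scal_iff[OF assms(2)] by auto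
    have "\<beta> (j + k - 1) + \<beta> (n + k - (j + k - 1)) = 1"
      using \<beta> r unfolding T_scal_iff[OF assms(2)] by blast
    moreover have "\<beta> (j + k - 1) \<le> \<beta> (n + k - (j + k - 1))"
      using j m assms(2) by (intro mono) auto
    ultimately show "\<beta> (j + k - 1) \<le> 1/2" by simp
  qed
  moreover have "\<beta> (i + k - 1) \<le> \<beta> (j + k - 1)" if "1 \<le> i" "i \<le> j" "j \<le> half_dim k n" for i j
    using that m assms(2) by (intro mono) auto
  ultimately show ?thesis
    by (auto simp: half_simplex_def fold_linear_def coord_space_def mono_on_def)
qed

lemma bij_betw_unfold:
  assumes "n \<ge> 1" "k \<in> {1,2}"
  shows "bij_betw (\<lambda>x. unfold_const k n + unfold_linear k n x)
    (half_simplex (half_dim k n)) (T_scal k n)"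
  by (rule bij_betw_byWitness[where f' = "fold_linear k n"])
    (use fold_unfold(2)[OF assms] unfold_fold[OF assms] unfold_mem[OF assms] fold_mem[OF assms]
      in \<open>auto simp: half_simplex_def\<close>)

text \<open>Convex hulls commute with affine maps, so the images of the vertices span the affine
  hull; they stay affinely independent because folding undoes the linear part.\<close>

lemma dim_T_HOR_eq:
  assumes "n \<ge> 1" "k \<in> {1,2}"
  shows "dim_T_HOR k n = half_dim k n"
proof -
  let ?m = "half_dim k n"
  let ?C = "half_vertex ?m ` {..<Suc ?m}"
  let ?L = "unfold_linear k n" and ?c = "unfold_const k n"
  have C: "?C \<subseteq> coord_space ?m" using half_vertex_mem by (auto simp: half_simplex_def)
  have inv: "fold_linear k n (?L x) = x" if "x \<in> ?C" for x
    using fold_unfold(1)[OF assms] C that by blast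
  have "T_scal k n = (\<lambda>x. ?c + ?L x) ` (convex hull ?C)"
    using bij_betw_unfold[OF assms] by (simp add: bij_betw_def convex_hull_half_vertex)
  also have "\<dots> = (+) ?c ` (?L ` (convex hull ?C))" by (simp only: image_image)
  also have "\<dots> = convex hull ((+) ?c ` ?L ` ?C)"
    by (simp only: convex_hull_linear_image[OF linear_unfold_linear] convex_hull_translation)
  finally have "affine hull ((+) ?c ` ?L ` ?C) = affine hull (T_scal k n)"
    by (simp only: affine_hull_convex_hull)
  moreover have "\<not> affine_dependent ((+) ?c ` ?L ` ?C)"
    unfolding affine_dependent_translation_eq[symmetric]
    by (rule affine_independent_linear_image[OF _ affine_independent_half_vertex linear_fold_linear])
      (use inv in auto)
  moreover have "card ((+) ?c ` ?L ` ?C) = ?m + 1"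
  proof -
    have "inj_on ?L ?C" using inv by (metis inj_onI)
    then show ?thesis
      by (simp add: card_image inj_on_half_vertex del: image_image)
  qed
  ultimately show ?thesis
    unfolding dim_T_HOR_def by (intro affine_dimension_eq) auto
qed

section \<open>Relative interior and polynomials\<close>

abbreviation turn :: "real \<Rightarrow> complex" where
  "turn a \<equiv> cis (- 2 * pi * a)"

lemma turn_eq_iff: "turn a = turn b \<longleftrightarrow> a - b \<in> \<int>"
proof
  assume "turn a = turn b"
  then obtain m :: int where "- 2 * pi * a = - 2 * pi * b + 2 * pi * of_int m"
    using sin_cos_eq_iff[of "- 2 * pi * a" "- 2 * pi * b"] by (auto simp: complex_eq_iff)
  then have "pi * (2 * (b - a)) = pi * (2 * of_int m)" by (simp add: algebra_simps)
  then have "b - a = of_int m" by simp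
  then have "a - b = of_int (- m)" by simp
  then show "a - b \<in> \<int>" by (metis Ints_of_int)
next
  assume "a - b \<in> \<int>"
  then obtain m where "a - b = of_int m" by (auto elim: Ints_cases)
  then have "a = b + of_int m" by simp
  then have "- 2 * pi * a = - 2 * pi * b + 2 * pi * of_int (- m)"
    by (simp add: algebra_simps)
  then have "sin (- 2 * pi * a) = sin (- 2 * pi * b) \<and> cos (- 2 * pi * a) = cos (- 2 * pi * b)"
    using sin_cos_eq_iff by blast
  then show "turn a = turn b" by (simp add: complex_eq_iff)
qed

lemma turn_eq_iff_unit_interval:
  assumes "0 \<le> a" "a < 1" "0 \<le> b" "b < 1"
  shows "turn a = turn b \<longleftrightarrow> a = b"
proof -
  have "a - b \<in> \<int> \<Longrightarrow> a = b"
  proof (elim Ints_cases)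
    fix m assume m: "a - b = of_int m"
    then have "-1 < real_of_int m" "real_of_int m < 1" using assms by linarith+
    then have "m = 0" by linarith
    then show "a = b" using m by simp
  qed
  then show ?thesis unfolding turn_eq_iff by auto
qed

section \<open>Strict parameters and the relative interior\<close>

text \<open>For \<open>k = 2\<close> the lower end \<open>\<beta> 1 = 0\<close> is an equation, so
  positivity is asked for \<open>k = 1\<close> only.\<close>

definition strict_params :: "nat \<Rightarrow> nat \<Rightarrow> (nat \<Rightarrow> real) \<Rightarrow> bool" where
  "strict_params k n \<beta> \<longleftrightarrow>
     (\<forall>j\<in>{1..<n}. \<beta> j < \<beta> (Suc j)) \<and> (k = 1 \<longrightarrow> 0 < \<beta> 1) \<and> \<beta> n < 1"

text \<open>The equations of the parameter set without its inequalities: an affine space that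
  contains the affine hull.\<close>

definition sym_space :: "nat \<Rightarrow> nat \<Rightarrow> (nat \<Rightarrow> real) set" where
  "sym_space k n = {\<beta> \<in> coord_space n.
     (k = 2 \<longrightarrow> \<beta> 1 = 0) \<and> (\<forall>j\<in>{k..n}. \<beta> j + \<beta> (n + k - j) = 1)}"

lemma T_scal_D:
  assumes "k \<in> {1,2}" "\<beta> \<in> T_scal k n"
  shows "\<And>j. 0 \<le> \<beta> j" "\<And>j. \<beta> j \<le> 1" "\<And>i j. 1 \<le> i \<Longrightarrow> i \<le> j \<Longrightarrow> j \<le> n \<Longrightarrow> \<beta> i \<le> \<beta> j"
    "k = 2 \<Longrightarrow> \<beta> 1 = 0" "\<And>j. k \<le> j \<Longrightarrow> j \<le> n \<Longrightarrow> \<beta> j + \<beta> (n + k - j) = 1"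
    "\<And>j. j \<notin> {1..n} \<Longrightarrow> \<beta> j = 0"
proof -
  note * = assms(2)[unfolded T_scal_iff[OF assms(1)]]
  show out: "\<And>j. j \<notin> {1..n} \<Longrightarrow> \<beta> j = 0"
    using * by (auto simp: coord_space_def)
  show "0 \<le> \<beta> j" "\<beta> j \<le> 1" for j
    using * out[of j] by (cases "j \<in> {1..n}"; force)+
  show "\<beta> i \<le> \<beta> j" if "1 \<le> i" "i \<le> j" "j \<le> n" for i j
    using * that by (auto simp: mono_on_def)
  show "k = 2 \<Longrightarrow> \<beta> 1 = 0" using * by blast
  show "\<beta> j + \<beta> (n + k - j) = 1" if "k \<le> j" "j \<le> n" for j
    using * that by auto
qed

lemma strict_params_less:
  assumes "strict_params k n \<beta>" "1 \<le> i" "i < j" "j \<le> n"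
  shows "\<beta> i < \<beta> j"
proof -
  have "Suc i \<le> j" using assms by simp
  then show ?thesis using assms(4)
  proof (induction j rule: dec_induct)
    case base
    then show ?case using assms by (auto simp: strict_params_def)
  next
    case (step j)
    then have "\<beta> j < \<beta> (Suc j)" using assms by (auto simp: strict_params_def)
    with step show ?case by simp
  qed
qed

text \<open>On \<open>[0,1)\<close> distinct angles give distinct points, so in an ordered family
  roots collide only between equal neighbours or between the values \<open>0\<close> and
  \<open>1\<close>.\<close>

lemma inj_turn_iff_strict:
  assumes "n \<ge> 1" "k \<in> {1,2}" and \<beta>: "\<beta> \<in> T_scal k n"
  shows "inj_on (\<lambda>j. turn (\<beta> j)) {1..n} \<longleftrightarrow> strict_params k n \<beta>"
proof
  note D = T_scal_D[OF assms(2) \<beta>]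
  assume inj: "inj_on (\<lambda>j. turn (\<beta> j)) {1..n}"
  have "\<beta> j < \<beta> (Suc j)" if "j \<in> {1..<n}" for j
  proof -
    have "\<beta> j \<noteq> \<beta> (Suc j)"
      using inj_onD[OF inj, of j "Suc j"] that by auto
    moreover have "\<beta> j \<le> \<beta> (Suc j)" using that by (intro D(3)) auto
    ultimately show ?thesis by simp
  qed
  \<comment> \<open>The value \<open>\<beta> n = 1\<close> comes with \<open>\<beta> 1 = 0\<close>,
    by symmetry for \<open>k = 1\<close> and by definition for \<open>k = 2\<close>; both give the
    same root.\<close>
  moreover have "\<beta> n \<noteq> 1"
  proof
    assume n1: "\<beta> n = 1"
    have "\<beta> 1 = 0" using D(4) D(5)[of n] assms n1 by auto
    then have "n \<noteq> 1" using n1 by auto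
    moreover have "turn (\<beta> 1) = turn (\<beta> n)"
      unfolding turn_eq_iff using \<open>\<beta> 1 = 0\<close> n1 by simp
    ultimately show False using inj_onD[OF inj, of 1 n] assms(1) by auto
  qed
  moreover have "0 < \<beta> 1" if "k = 1"
    using D(1)[of 1] D(5)[of 1] that assms(1) \<open>\<beta> n \<noteq> 1\<close> by (cases "\<beta> 1 = 0") auto
  ultimately show "strict_params k n \<beta>"
    using D(2)[of n] by (auto simp: strict_params_def)
next
  note D = T_scal_D[OF assms(2) \<beta>]
  assume s: "strict_params k n \<beta>"
  have less1: "\<beta> j < 1" if "j \<in> {1..n}" for j
    using D(3)[of j n] that s by (auto simp: strict_params_def)
  show "inj_on (\<lambda>j. turn (\<beta> j)) {1..n}"
  proof (rule linorder_inj_onI)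
    fix i j assume ij: "i < j" "i \<in> {1..n}" "j \<in> {1..n}"
    then have "\<beta> i \<noteq> \<beta> j" using strict_params_less[OF s, of i j] by auto
    then show "turn (\<beta> i) \<noteq> turn (\<beta> j)"
      using turn_eq_iff_unit_interval[of "\<beta> i" "\<beta> j"] D(1) less1 ij by blast
  qed auto
qed

text \<open>Strict inequalities are an open condition, so this provides relatively open
  neighbourhoods inside the parameter set.\<close>

lemma strict_sym_mem_T_scal:
  assumes "n \<ge> 1" "k \<in> {1,2}" "\<beta> \<in> sym_space k n" and s: "strict_params k n \<beta>"
  shows "\<beta> \<in> T_scal k n"
proof -
  have mono: "\<beta> i \<le> \<beta> j" if "1 \<le> i" "i \<le> j" "j \<le> n" for i j
    using strict_params_less[OF s, of i j] that by (cases "i = j") auto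
  have "0 \<le> \<beta> 1" using assms(2,3) s by (auto simp: sym_space_def strict_params_def)
  moreover have "\<beta> n \<le> 1" using s by (auto simp: strict_params_def)
  ultimately have "0 \<le> \<beta> j" "\<beta> j \<le> 1" if "j \<in> {1..n}" for j
    using mono[of 1 j] mono[of j n] that by auto
  then show ?thesis
    using assms(3) mono unfolding T_scal_iff[OF assms(2)]
    by (auto simp: sym_space_def mono_on_def)
qed

lemma affine_sym_space: "affine (sym_space k n)"
proof -
  have "u * x j + v * y j + (u * x (n + k - j) + v * y (n + k - j)) = 1"
    if "x j + x (n + k - j) = 1" "y j + y (n + k - j) = 1" "u + v = 1"
    for x y :: "nat \<Rightarrow> real" and u v j
  proof -
    have "u * x j + v * y j + (u * x (n + k - j) + v * y (n + k - j))
        = u * (x j + x (n + k - j)) + v * (y j + y (n + k - j))"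
      by (simp add: algebra_simps)
    then show ?thesis using that by simp
  qed
  then show ?thesis
    by (auto simp: affine_def sym_space_def coord_space_def)
qed

lemma affine_hull_T_scal_subset:
  assumes "k \<in> {1,2}"
  shows "affine hull T_scal k n \<subseteq> sym_space k n"
  by (rule hull_minimal[where S = affine, OF _ affine_sym_space])
    (use T_scal_iff[OF assms] in \<open>auto simp: sym_space_def\<close>)

lemma open_strict_params: "open {\<beta>. strict_params k n \<beta>}"
proof -
  have [simp]: "continuous_on UNIV (\<lambda>\<beta>::nat \<Rightarrow> real. \<beta> j)" for j
    by (rule continuous_on_product_coordinates)
  have "{\<beta>. strict_params k n \<beta>} = (\<Inter>j\<in>{1..<n}. {\<beta>. \<beta> j < \<beta> (Suc j)})
     \<inter> {\<beta>. k = 1 \<longrightarrow> 0 < \<beta> 1} \<inter> {\<beta>. \<beta> n < 1}"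
    by (auto simp: strict_params_def)
  moreover have "open {\<beta>::nat \<Rightarrow> real. k = 1 \<longrightarrow> 0 < \<beta> 1}"
    by (cases "k = 1") (auto intro!: open_Collect_less)
  ultimately show ?thesis
    by (auto intro!: open_Int open_INT open_Collect_less)
qed

text \<open>Equidistant angles, the parameter of the unit matrix: the corresponding roots are the
  \<open>n\<close>-th roots of \<open>(-1)^k\<close>.\<close>

definition center :: "nat \<Rightarrow> nat \<Rightarrow> nat \<Rightarrow> real" where
  "center k n j = (if j \<in> {1..n} then (real j - real k / 2) / real n else 0)"

lemma strict_center: "n \<ge> 1 \<Longrightarrow> k \<in> {1,2} \<Longrightarrow> strict_params k n (center k n)"
  by (auto simp: strict_params_def center_def divide_strict_right_mono)

lemma center_mem:
  assumes "n \<ge> 1" "k \<in> {1,2}"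
  shows "center k n \<in> T_scal k n"
proof (rule strict_sym_mem_T_scal[OF assms _ strict_center[OF assms]])
  have "center k n j + center k n (n + k - j) = 1" if "j \<in> {k..n}" for j
  proof -
    have "n + k - j \<in> {1..n}" "j \<in> {1..n}" using that assms by auto
    moreover have "real (n + k - j) = real n + real k - real j" using that by simp
    ultimately show ?thesis
      using assms by (simp add: center_def field_simps)
  qed
  then show "center k n \<in> sym_space k n"
    by (auto simp: sym_space_def coord_space_def center_def)
qed

text \<open>The strict points of the affine hull form a relatively open subset of the parameter set.
  Conversely, around a relatively interior point there is room for a small step beyond it.\<close>

lemma rel_interior_T_scal:
  assumes "n \<ge> 1" "k \<in> {1,2}"
  shows "rel_interior (T_scal k n) = {\<beta> \<in> T_scal k n. strict_params k n \<beta>}"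
proof (intro equalityI subsetI)
  fix \<beta> assume "\<beta> \<in> {\<beta> \<in> T_scal k n. strict_params k n \<beta>}"
  then have \<beta>: "\<beta> \<in> T_scal k n" "strict_params k n \<beta>" by auto
  have "openin (top_of_set (affine hull T_scal k n))
      (affine hull T_scal k n \<inter> {\<beta>. strict_params k n \<beta>})"
    using open_strict_params by (rule openin_open_Int)
  moreover have "affine hull T_scal k n \<inter> {\<beta>. strict_params k n \<beta>} \<subseteq> T_scal k n"
    using affine_hull_T_scal_subset[OF assms(2)] strict_sym_mem_T_scal[OF assms] by blast
  ultimately show "\<beta> \<in> rel_interior (T_scal k n)"
    unfolding rel_interior_def using \<beta> hull_inc[OF \<beta>(1), of affine] by blast
next
  fix \<beta> assume "\<beta> \<in> rel_interior (T_scal k n)"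
  then obtain V where V: "open V" "\<beta> \<in> V" "affine hull T_scal k n \<inter> V \<subseteq> T_scal k n"
    and "\<beta> \<in> T_scal k n"
    unfolding rel_interior_def openin_open by blast
  let ?c = "center k n"
  \<comment> \<open>Moving from \<open>\<beta>\<close> away from the center violates every constraint that is not strict at \<open>\<beta>\<close>.\<close>
  define g where "g t = (\<lambda>j. \<beta> j + t * (\<beta> j - ?c j))" for t
  have "continuous_on UNIV g"
    unfolding g_def by (intro continuous_on_coordinatewise_then_product continuous_intros)
  then have "open (g -` V)" using V(1) by (simp add: open_vimage)
  moreover have "0 \<in> g -` V" using V(2) by (simp add: g_def)
  ultimately obtain e where "e > 0" "ball 0 e \<subseteq> g -` V"
    using openE by blast
  then have t: "e/2 > 0" "g (e/2) \<in> V"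
    using subsetD[of "ball 0 e" "g -` V" "e/2"] by auto
  define t where "t = e/2"
  have "g t = (1 + t) *\<^sub>R \<beta> + (- t) *\<^sub>R ?c"
    by (auto simp: g_def fun_eq_iff algebra_simps)
  also have "\<dots> \<in> affine hull T_scal k n"
    by (rule mem_affine[OF affine_affine_hull]) (auto intro!: hull_inc \<open>\<beta> \<in> T_scal k n\<close> center_mem[OF assms])
  finally have g: "g t \<in> T_scal k n" using V(3) t by (auto simp: t_def)
  have "t > 0" using t by (simp add: t_def)
  note D = T_scal_D[OF assms(2) \<open>\<beta> \<in> T_scal k n\<close>] and G = T_scal_D[OF assms(2) g]
  note C = strict_center[OF assms, unfolded strict_params_def]
  have "\<beta> j < \<beta> (Suc j)" if j: "j \<in> {1..<n}" for j
  proof (rule ccontr)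
    assume "\<not> \<beta> j < \<beta> (Suc j)"
    with D(3)[of j "Suc j"] j have "\<beta> j = \<beta> (Suc j)" by auto
    moreover have "g t j \<le> g t (Suc j)" using j by (intro G(3)) auto
    ultimately have "t * ?c (Suc j) \<le> t * ?c j" by (simp add: g_def algebra_simps)
    moreover have "?c j < ?c (Suc j)" using C j by blast
    ultimately show False using \<open>t > 0\<close> by simp
  qed
  moreover have "0 < \<beta> 1" if "k = 1"
  proof (rule ccontr)
    assume "\<not> 0 < \<beta> 1"
    with D(1)[of 1] have "\<beta> 1 = 0" by simp
    then have "0 \<le> - (t * ?c 1)" using G(1)[of 1] by (simp add: g_def)
    moreover have "0 < t * ?c 1" using \<open>t > 0\<close> C that by simp
    ultimately show False by simp
  qed
  moreover have "\<beta> n < 1"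
  proof (rule ccontr)
    assume "\<not> \<beta> n < 1"
    with D(2)[of n] have "\<beta> n = 1" by simp
    then have "1 + t * (1 - ?c n) \<le> 1" using G(2)[of n] by (simp add: g_def)
    moreover have "0 < t * (1 - ?c n)" using \<open>t > 0\<close> C by simp
    ultimately show False by simp
  qed
  ultimately show "\<beta> \<in> {\<beta> \<in> T_scal k n. strict_params k n \<beta>}"
    using \<open>\<beta> \<in> T_scal k n\<close> by (simp add: strict_params_def)
qed

section \<open>The polynomials with the given roots: reality, symmetry of the coefficients, the
  central one\<close>

definition turn_poly :: "nat \<Rightarrow> (nat \<Rightarrow> real) \<Rightarrow> complex poly" where
  "turn_poly n \<beta> = (\<Prod>j=1..n. [:- turn (\<beta> j), 1:])"

lemma monic_prod_linear:
  fixes c :: "'i \<Rightarrow> 'a :: idom"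
  shows "finite A \<Longrightarrow> degree (\<Prod>j\<in>A. [:- c j, 1:]) = card A \<and> lead_coeff (\<Prod>j\<in>A. [:- c j, 1:]) = 1"
proof (induction A rule: finite_induct)
  case (insert a A)
  then have nz: "(\<Prod>j\<in>A. [:- c j, 1:]) \<noteq> 0" by auto
  have "degree ([:- c a, 1:] * (\<Prod>j\<in>A. [:- c j, 1:])) = Suc (card A)"
    using insert nz by (subst degree_mult_eq) auto
  moreover have "lead_coeff ([:- c a, 1:] * (\<Prod>j\<in>A. [:- c j, 1:])) = 1"
    using insert by (subst lead_coeff_mult) auto
  ultimately show ?case using insert by simp
qed simp

lemma degree_turn_poly: "degree (turn_poly n \<beta>) = n"
  and coeff_turn_poly_n: "coeff (turn_poly n \<beta>) n = 1"
  using monic_prod_linear[of "{1..n}" "\<lambda>j. turn (\<beta> j)"] by (auto simp: turn_poly_def)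

text \<open>Complex conjugation permutes the roots by this involution.\<close>

definition refl_index :: "nat \<Rightarrow> nat \<Rightarrow> nat \<Rightarrow> nat" where
  "refl_index k n j = (if j < k then j else n + k - j)"

lemma bij_refl_index:
  assumes "n \<ge> 1" "k \<in> {1,2}"
  shows "bij_betw (refl_index k n) {1..n} {1..n}"
  by (rule bij_betw_byWitness[where f' = "refl_index k n"])
    (use assms in \<open>auto simp: refl_index_def\<close>)

text \<open>For \<open>k = 2\<close> the index \<open>1\<close> is its own mirror image, with value
  \<open>0\<close>. In all cases the sum is an integer, so mirror indices carry conjugate
  roots.\<close>

lemma T_scal_refl:
  assumes "k \<in> {1,2}" "\<beta> \<in> T_scal k n" "j \<in> {1..n}"
  shows "\<beta> j + \<beta> (refl_index k n j) = (if j < k then 0 else 1)"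
proof -
  have "j = 1 \<and> k = 2" if "j < k" using that assms by auto
  then show ?thesis
    using T_scal_D(4,5)[OF assms(1,2)] assms(3) by (auto simp: refl_index_def)
qed

lemma cnj_turn_T_scal:
  assumes "k \<in> {1,2}" "\<beta> \<in> T_scal k n" "j \<in> {1..n}"
  shows "cnj (turn (\<beta> j)) = turn (\<beta> (refl_index k n j))"
proof -
  have "cnj (turn (\<beta> j)) = turn (- \<beta> j)" by (simp add: cis_cnj)
  also have "\<dots> = turn (\<beta> (refl_index k n j))"
  proof -
    have "- \<beta> j - \<beta> (refl_index k n j) = (if j < k then 0 else -1)"
      using T_scal_refl[OF assms] by (auto split: if_splits)
    then show ?thesis unfolding turn_eq_iff by simp
  qed
  finally show ?thesis .
qed

lemma prod_cnj_turn:
  assumes "n \<ge> 1" "k \<in> {1,2}" "\<beta> \<in> T_scal k n"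
  shows "(\<Prod>j=1..n. [:- cnj (turn (\<beta> j)), 1:]) = turn_poly n \<beta>"
proof -
  have "(\<Prod>j=1..n. [:- cnj (turn (\<beta> j)), 1:]) = (\<Prod>j=1..n. [:- turn (\<beta> (refl_index k n j)), 1:])"
    using cnj_turn_T_scal[OF assms(2,3)] by (intro prod.cong) auto
  also have "\<dots> = turn_poly n \<beta>"
    unfolding turn_poly_def
    by (rule prod.reindex_bij_betw[OF bij_refl_index[OF assms(1,2)], of "\<lambda>j. [:- turn (\<beta> j), 1:]"])
  finally show ?thesis .
qed

lemma map_poly_cnj_prod_linear:
  "finite A \<Longrightarrow> map_poly cnj (\<Prod>j\<in>A. [:- c j, 1:]) = (\<Prod>j\<in>A. [:- cnj (c j), 1:])"
proof -
  interpret cnj: comm_ring_hom cnj by unfold_locales auto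
  interpret map_cnj: map_poly_comm_ring_hom cnj ..
  show "finite A \<Longrightarrow> ?thesis"
    by (simp add: map_cnj.hom_prod map_poly_pCons)
qed

lemma map_poly_of_real_inj:
  "map_poly complex_of_real p = map_poly complex_of_real q \<longleftrightarrow> p = q"
  by (auto simp: poly_eq_iff coeff_map_poly)

text \<open>Conjugation permutes the roots, so the coefficients are real; taking real parts gives
  the polynomial that the description in \<open>Pi_poly\<close> asks for.\<close>

lemma map_poly_Pi_poly:
  assumes "n \<ge> 1" "k \<in> {1,2}" "\<beta> \<in> T_scal k n"
  shows "map_poly complex_of_real (Pi_poly n \<beta>) = turn_poly n \<beta>"
proof -
  have "map_poly cnj (turn_poly n \<beta>) = turn_poly n \<beta>"
    using prod_cnj_turn[OF assms] by (simp add: turn_poly_def map_poly_cnj_prod_linear)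
  then have "cnj (coeff (turn_poly n \<beta>) i) = coeff (turn_poly n \<beta>) i" for i
    by (metis coeff_map_poly complex_cnj_zero)
  then have eq: "map_poly complex_of_real (map_poly Re (turn_poly n \<beta>)) = turn_poly n \<beta>"
    by (intro poly_eqI) (simp add: coeff_map_poly complex_eq_iff)
  show ?thesis
    unfolding Pi_poly_def turn_poly_def[symmetric]
    by (rule theI[where a = "map_poly Re (turn_poly n \<beta>)"])
      (simp_all add: eq flip: map_poly_of_real_inj)
qed

lemma coeff_Pi_poly:
  assumes "n \<ge> 1" "k \<in> {1,2}" "\<beta> \<in> T_scal k n"
  shows "complex_of_real (coeff (Pi_poly n \<beta>) i) = coeff (turn_poly n \<beta>) i"
  unfolding map_poly_Pi_poly[OF assms, symmetric] by (simp add: coeff_map_poly)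

lemma degree_Pi_poly:
  assumes "n \<ge> 1" "k \<in> {1,2}" "\<beta> \<in> T_scal k n"
  shows "degree (Pi_poly n \<beta>) = n"
  using degree_turn_poly[of n \<beta>] unfolding map_poly_Pi_poly[OF assms, symmetric]
  by (simp add: degree_map_poly)

lemma coeff_Pi_poly_n:
  assumes "n \<ge> 1" "k \<in> {1,2}" "\<beta> \<in> T_scal k n"
  shows "coeff (Pi_poly n \<beta>) n = 1"
  using coeff_Pi_poly[OF assms, of n] by (simp add: coeff_turn_poly_n)

lemma prod_cis: "finite A \<Longrightarrow> (\<Prod>j\<in>A. cis (f j)) = cis (\<Sum>j\<in>A. f j)"
  by (induction A rule: finite_induct) (auto simp: cis_mult)

text \<open>Adding the sum to its reflection gives \<open>1\<close> for every index from
  \<open>k\<close> on and \<open>0\<close> before.\<close>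

lemma sum_T_scal:
  assumes "n \<ge> 1" "k \<in> {1,2}" "\<beta> \<in> T_scal k n"
  shows "2 * (\<Sum>j=1..n. \<beta> j) = real (n + 1 - k)"
proof -
  have "2 * (\<Sum>j=1..n. \<beta> j) = (\<Sum>j=1..n. \<beta> j) + (\<Sum>j=1..n. \<beta> (refl_index k n j))"
    using sum.reindex_bij_betw[OF bij_refl_index[OF assms(1,2)], of \<beta>] by simp
  also have "\<dots> = (\<Sum>j=1..n. if j < k then 0 else 1)"
    unfolding sum.distrib[symmetric] using T_scal_refl[OF assms(2,3)] by (intro sum.cong) auto
  also have "\<dots> = (\<Sum>j\<in>{k..n}. 1)"
    using assms(2) by (intro sum.mono_neutral_cong_right) auto
  finally show ?thesis by simp
qed

text \<open>This is the constant coefficient. The sum of the angles yields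
  \<open>(-1)^(n+1-k)\<close>, the minus signs yield \<open>(-1)^n\<close>, and the total exponent
  has the parity of \<open>k + 1\<close>.\<close>

lemma prod_uminus_turn:
  assumes "n \<ge> 1" "k \<in> {1,2}" "\<beta> \<in> T_scal k n"
  shows "(\<Prod>j=1..n. - turn (\<beta> j)) = - ((-1) ^ k)"
proof -
  have "(\<Sum>j=1..n. - 2 * pi * \<beta> j) = real (n + 1 - k) * (- pi)"
    unfolding sum_T_scal[OF assms, symmetric] sum_distrib_left[symmetric] by simp
  then have "(\<Prod>j=1..n. turn (\<beta> j)) = cis (- pi) ^ (n + 1 - k)"
    by (simp only: prod_cis finite_atLeastAtMost Complex.DeMoivre)
  also have "cis (- pi) = -1" by (simp add: complex_eq_iff)
  finally have "(\<Prod>j=1..n. - turn (\<beta> j)) = (-1) ^ n * (-1) ^ (n + 1 - k)"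
    using prod_uminus[of "\<lambda>j. turn (\<beta> j)" "{1..n}"] by simp
  also have "\<dots> = - ((-1) ^ k)"
    using assms(1,2) by (auto simp: power_add[symmetric] mult_2[symmetric] Suc_diff_le)
  finally show ?thesis .
qed

text \<open>Reversing the coefficients inverts the roots. On the unit circle inversion is
  conjugation, which permutes the roots, so the reversed polynomial is the original times its
  constant coefficient.\<close>

lemma coeff_Pi_poly_palindromic:
  assumes "n \<ge> 1" "k \<in> {1,2}" "\<beta> \<in> T_scal k n" "d \<le> n"
  shows "coeff (Pi_poly n \<beta>) d = - ((-1) ^ k * coeff (Pi_poly n \<beta>) (n - d))"
proof -
  have "reflect_poly (turn_poly n \<beta>) = (\<Prod>j=1..n. reflect_poly [:- turn (\<beta> j), 1:])"
    unfolding turn_poly_def by (rule reflect_poly_prod)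
  also have "\<dots> = (\<Prod>j=1..n. Polynomial.smult (- turn (\<beta> j)) [:- cnj (turn (\<beta> j)), 1:])"
  proof (rule prod.cong[OF refl])
    fix j
    have "turn (\<beta> j) * cnj (turn (\<beta> j)) = 1" by (simp add: cis_cnj cis_mult)
    moreover have "reflect_poly [:- turn (\<beta> j), 1:] = [:1, - turn (\<beta> j):]"
      by (simp add: reflect_poly_def)
    ultimately show "reflect_poly [:- turn (\<beta> j), 1:] = Polynomial.smult (- turn (\<beta> j)) [:- cnj (turn (\<beta> j)), 1:]"
      by simp
  qed
  also have "\<dots> = Polynomial.smult (\<Prod>j=1..n. - turn (\<beta> j)) (\<Prod>j=1..n. [:- cnj (turn (\<beta> j)), 1:])"
    by (rule prod_smult)
  also have "\<dots> = Polynomial.smult (- ((-1) ^ k)) (turn_poly n \<beta>)"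
    using prod_uminus_turn[OF assms(1-3)] prod_cnj_turn[OF assms(1-3)] by simp
  finally have "coeff (reflect_poly (turn_poly n \<beta>)) (n - d) = - ((-1) ^ k) * coeff (turn_poly n \<beta>) (n - d)"
    by simp
  moreover have "coeff (reflect_poly (turn_poly n \<beta>)) (n - d) = coeff (turn_poly n \<beta>) d"
    using assms(4) by (simp add: coeff_reflect_poly degree_turn_poly)
  ultimately have "complex_of_real (coeff (Pi_poly n \<beta>) d)
      = complex_of_real (- ((-1) ^ k * coeff (Pi_poly n \<beta>) (n - d)))"
    by (simp add: coeff_Pi_poly[OF assms(1-3)])
  then show ?thesis by (simp only: of_real_eq_iff)
qed

text \<open>Both sides are monic of degree \<open>n\<close> and vanish at the \<open>n\<close>
  distinct points \<open>?c j\<close>: in the \<open>n\<close>-th power of such a point the integer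
  \<open>j\<close> becomes full turns and disappears.\<close>

lemma Pi_poly_center:
  assumes "n \<ge> 1" "k \<in> {1,2}"
  shows "Pi_poly n (center k n) = monom 1 n - [:(-1) ^ k:]"
proof -
  let ?c = "\<lambda>j. turn (center k n j)"
  let ?q = "monom 1 n - [:(-1) ^ k:] :: complex poly"
  have inj: "inj_on ?c {1..n}"
    using inj_turn_iff_strict[OF assms center_mem[OF assms]] strict_center[OF assms] by blast
  have "turn_poly n (center k n) = ?q"
  proof (rule poly_eqI_degree_lead_coeff[where n = n and A = "?c ` {1..n}"])
    show "coeff (turn_poly n (center k n)) n = coeff ?q n"
      using assms(1) by (simp add: coeff_turn_poly_n coeff_pCons split: nat.splits)
    show "n \<le> card (?c ` {1..n})" using inj by (simp add: card_image)
    show "degree (turn_poly n (center k n)) \<le> n" by (simp add: degree_turn_poly)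
    show "degree ?q \<le> n"
      using degree_diff_le_max[of "monom (1::complex) n" "[:(-1) ^ k:]"] by (simp add: degree_monom_eq)
  next
    fix z assume "z \<in> ?c ` {1..n}"
    then obtain j where j: "j \<in> {1..n}" "z = ?c j" by blast
    have "poly (turn_poly n (center k n)) z = 0"
      using j by (auto simp: turn_poly_def poly_prod)
    moreover have "z ^ n = (-1) ^ k"
    proof -
      have "z ^ n = turn (real j - real k / 2)"
        using j assms by (simp add: Complex.DeMoivre center_def)
      also have "\<dots> = turn (- real k / 2)"
        unfolding turn_eq_iff by simp
      also have "\<dots> = cis (real k * pi)" by (simp add: mult_ac)
      also have "\<dots> = (-1) ^ k" by (simp add: Complex.DeMoivre[symmetric])
      finally show ?thesis .
    qed
    ultimately show "poly (turn_poly n (center k n)) z = poly ?q z"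
      by (simp add: poly_monom)
  qed
  moreover have "?q = map_poly complex_of_real (monom 1 n - [:(-1) ^ k:])"
    by (intro poly_eqI) (auto simp: coeff_map_poly coeff_pCons split: nat.splits)
  ultimately have "map_poly complex_of_real (Pi_poly n (center k n))
      = map_poly complex_of_real (monom 1 n - [:(-1) ^ k:])"
    using map_poly_Pi_poly[OF assms center_mem[OF assms]] by simp
  then show ?thesis by (simp add: map_poly_of_real_inj)
qed

lemma S_mat_center:
  assumes "n \<ge> 1" "k \<in> {1,2}"
  shows "S_mat n (Pi_poly n (center k n)) = 1\<^sub>m n"
  unfolding Pi_poly_center[OF assms]
  by (intro eq_matI) (auto simp: coeff_pCons split: nat.splits)

text \<open>The first row lists all coefficients but the constant one, which the symmetry recovers
  from the leading one.\<close>

lemma inj_on_S_mat: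
  assumes "n \<ge> 1" "k \<in> {1,2}"
  shows "inj_on (S_mat n) (T_pol k n)"
proof (rule inj_onI)
  fix p q assume "p \<in> T_pol k n" "q \<in> T_pol k n" and S: "S_mat n p = S_mat n q"
  then obtain \<beta> \<gamma> where \<beta>: "\<beta> \<in> T_scal k n" "p = Pi_poly n \<beta>" and \<gamma>: "\<gamma> \<in> T_scal k n" "q = Pi_poly n \<gamma>"
    by (auto simp: T_pol_def)
  have pos: "coeff p i = coeff q i" if "1 \<le> i" "i \<le> n" for i
  proof -
    have "S_mat n p $$ (0, n - i) = S_mat n q $$ (0, n - i)" using S by simp
    with that show ?thesis by simp
  qed
  show "p = q"
  proof (rule poly_eqI)
    fix i
    consider "i = 0" | "1 \<le> i" "i \<le> n" | "n < i" by linarith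
    then show "coeff p i = coeff q i"
    proof cases
      case 1
      then show ?thesis
        using coeff_Pi_poly_palindromic[OF assms \<beta>(1), of 0] coeff_Pi_poly_palindromic[OF assms \<gamma>(1), of 0]
          pos[of n] assms(1) \<beta>(2) \<gamma>(2) by simp
    next
      case 2
      then show ?thesis using pos by simp
    next
      case 3
      then show ?thesis
        using degree_Pi_poly[OF assms \<beta>(1)] degree_Pi_poly[OF assms \<gamma>(1)] \<beta>(2) \<gamma>(2)
        by (simp add: coeff_eq_0)
    qed
  qed
qed

section \<open>Recovering the parameters from the roots\<close>

lemma order_prod_linear:
  fixes c :: "'i \<Rightarrow> 'a :: idom"
  shows "finite A \<Longrightarrow> Polynomial.order a (\<Prod>j\<in>A. [:- c j, 1:]) = card {j\<in>A. c j = a}"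
proof (induction A rule: finite_induct)
  case (insert b A)
  have nz: "[:- c b, 1:] * (\<Prod>j\<in>A. [:- c j, 1:]) \<noteq> 0"
    unfolding mult_eq_0_iff using insert by auto
  have "{j \<in> insert b A. c j = a} = (if c b = a then insert b {j\<in>A. c j = a} else {j\<in>A. c j = a})"
    by auto
  moreover have "Polynomial.order a [:- c b, 1:] = (if c b = a then 1 else 0)"
    by (simp add: order_linear')
  ultimately show ?case
    using insert order_mult[OF nz] by (simp del: mult_pCons_left)
qed simp

text \<open>A value in \<open>[0,1]\<close> differs from an inner point \<open>t\<close> by less
  than \<open>1\<close>, so an integer difference must be \<open>0\<close>.\<close>

lemma card_turn_eq:
  assumes "k \<in> {1,2}" "\<beta> \<in> T_scal k n" "0 < t" "t < 1"
  shows "card {j\<in>{1..n}. turn (\<beta> j) = turn t} = card {j\<in>{1..n}. \<beta> j = t}"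
proof -
  have "turn (\<beta> j) = turn t \<longleftrightarrow> \<beta> j = t" for j
  proof
    assume "turn (\<beta> j) = turn t"
    then obtain m where m: "\<beta> j - t = of_int m"
      unfolding turn_eq_iff by (auto elim: Ints_cases)
    then have "-1 < real_of_int m" "real_of_int m < 1"
      using T_scal_D(1,2)[OF assms(1,2), of j] assms(3,4) by linarith+
    then have "m = 0" by linarith
    then show "\<beta> j = t" using m by simp
  qed simp
  then show ?thesis by simp
qed

lemma card_turn_eq_0:
  assumes "k \<in> {1,2}" "\<beta> \<in> T_scal k n"
  shows "card {j\<in>{1..n}. turn (\<beta> j) = turn 0} =
    card {j\<in>{1..n}. \<beta> j = 0} + card {j\<in>{1..n}. \<beta> j = 1}"
proof -
  have "turn (\<beta> j) = turn 0 \<longleftrightarrow> \<beta> j = 0 \<or> \<beta> j = 1" for j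
  proof
    assume "turn (\<beta> j) = turn 0"
    then obtain m where m: "\<beta> j = of_int m"
      unfolding turn_eq_iff by (auto elim: Ints_cases)
    then have "0 \<le> m" "m \<le> 1"
      using T_scal_D(1,2)[OF assms, of j] by auto
    then have "m = 0 \<or> m = 1" by linarith
    then show "\<beta> j = 0 \<or> \<beta> j = 1" using m by auto
  qed (unfold turn_eq_iff, auto)
  then have "{j\<in>{1..n}. turn (\<beta> j) = turn 0} = {j\<in>{1..n}. \<beta> j = 0} \<union> {j\<in>{1..n}. \<beta> j = 1}"
    by blast
  moreover have "{j\<in>{1..n}. \<beta> j = 0} \<inter> {j\<in>{1..n}. \<beta> j = 1} = {}" by auto
  ultimately show ?thesis by (simp add: card_Un_disjoint)
qed

text \<open>The parameters \<open>0\<close> and \<open>1\<close> give the same root; the symmetry separates their multiplicities.\<close>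

lemma card_zeros_T_scal:
  assumes "n \<ge> 1" "k \<in> {1,2}" "\<beta> \<in> T_scal k n"
  shows "card {j\<in>{1..n}. \<beta> j = 0} = card {j\<in>{1..n}. \<beta> j = 1} + (k - 1)"
proof -
  note D = T_scal_D[OF assms(2,3)]
  have "bij_betw (\<lambda>j. n + k - j) {j\<in>{k..n}. \<beta> j = 0} {j\<in>{1..n}. \<beta> j = 1}"
  proof (rule bij_betw_byWitness[where f' = "\<lambda>j. n + k - j"])
    have "k \<le> j" if "j \<in> {1..n}" "\<beta> j = 1" for j
      using that D(4) assms(2) by (cases "j = 1") auto
    then show "(\<lambda>j. n + k - j) ` {j\<in>{1..n}. \<beta> j = 1} \<subseteq> {j\<in>{k..n}. \<beta> j = 0}"
      using D(5) assms(2) by fastforce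
    show "(\<lambda>j. n + k - j) ` {j\<in>{k..n}. \<beta> j = 0} \<subseteq> {j\<in>{1..n}. \<beta> j = 1}"
      using D(5) assms(2) by fastforce
  qed auto
  then have "card {j\<in>{k..n}. \<beta> j = 0} = card {j\<in>{1..n}. \<beta> j = 1}"
    by (rule bij_betw_same_card)
  moreover have "{j\<in>{1..n}. \<beta> j = 0} = {j\<in>{k..n}. \<beta> j = 0} \<union> {1..<k}"
  proof (cases "k = 1")
    case False
    then have "k = 2" using assms(2) by simp
    then have "\<beta> 1 = 0" "{1..<k} = {1}" using D(4) by auto
    moreover have "{1..n} = insert 1 {k..n}" using \<open>k = 2\<close> assms(1) by auto
    ultimately show ?thesis by auto
  qed auto
  moreover have "{j\<in>{k..n}. \<beta> j = 0} \<inter> {1..<k} = {}" by auto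
  ultimately show ?thesis by (simp add: card_Un_disjoint)
qed

text \<open>Root multiplicities determine how often each value occurs among the parameters, and a
  sorted list is determined by its multiset.\<close>

lemma inj_on_Pi_poly:
  assumes "n \<ge> 1" "k \<in> {1,2}"
  shows "inj_on (Pi_poly n) (T_scal k n)"
proof (rule inj_onI)
  fix \<beta> \<gamma> assume \<beta>: "\<beta> \<in> T_scal k n" and \<gamma>: "\<gamma> \<in> T_scal k n" and eq: "Pi_poly n \<beta> = Pi_poly n \<gamma>"
  have "turn_poly n \<beta> = turn_poly n \<gamma>"
    using eq map_poly_Pi_poly[OF assms \<beta>] map_poly_Pi_poly[OF assms \<gamma>] by simp
  then have cards: "card {j\<in>{1..n}. turn (\<beta> j) = a} = card {j\<in>{1..n}. turn (\<gamma> j) = a}" for a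
    using order_prod_linear[of "{1..n}" a "\<lambda>j. turn (\<beta> j)"] order_prod_linear[of "{1..n}" a "\<lambda>j. turn (\<gamma> j)"]
    unfolding turn_poly_def by simp
  have count: "card {j\<in>{1..n}. \<beta> j = t} = card {j\<in>{1..n}. \<gamma> j = t}" for t
  proof -
    \<comment> \<open>For the values \<open>0\<close> and \<open>1\<close> the multiplicity of the
      root gives the sum of the counts, the symmetry their difference.\<close>
    have ends: "card {j\<in>{1..n}. \<beta> j = 1} = card {j\<in>{1..n}. \<gamma> j = 1}"
      "card {j\<in>{1..n}. \<beta> j = 0} = card {j\<in>{1..n}. \<gamma> j = 0}"
      using cards[of "turn 0"] card_turn_eq_0[OF assms(2) \<beta>] card_turn_eq_0[OF assms(2) \<gamma>]
        card_zeros_T_scal[OF assms \<beta>] card_zeros_T_scal[OF assms \<gamma>] by linarith+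
    have inner: ?thesis if "0 < t" "t < 1"
      using cards[of "turn t"] card_turn_eq[OF assms(2) \<beta> that] card_turn_eq[OF assms(2) \<gamma> that] by simp
    have outer: ?thesis if "t < 0 \<or> 1 < t"
    proof -
      have "{j\<in>{1..n}. \<beta> j = t} = {}" "{j\<in>{1..n}. \<gamma> j = t} = {}"
        using T_scal_D(1,2)[OF assms(2) \<beta>] T_scal_D(1,2)[OF assms(2) \<gamma>] that
        by (auto simp: not_less[symmetric])
      then show ?thesis by (simp only:)
    qed
    consider "t = 0" | "t = 1" | "0 < t" "t < 1" | "t < 0 \<or> 1 < t" by linarith
    then show ?thesis
      by cases (use ends inner outer in \<open>simp_all only:\<close>)
  qed
  have count_list: "count (mset (map x [1..<Suc n])) t = card {j\<in>{1..n}. x j = t}" for x :: "nat \<Rightarrow> real" and t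
  proof -
    have "count (mset (map x js)) t = length (filter (\<lambda>j. x j = t) js)" for js
      by (induction js) auto
    then have "count (mset (map x [1..<Suc n])) t = length (filter (\<lambda>j. x j = t) [1..<Suc n])" .
    also have "\<dots> = card (set (filter (\<lambda>j. x j = t) [1..<Suc n]))"
      by (rule distinct_card[symmetric]) simp
    also have "set (filter (\<lambda>j. x j = t) [1..<Suc n]) = {j\<in>{1..n}. x j = t}"
      by auto
    finally show ?thesis .
  qed
  have sorted: "sorted (map x [1..<Suc n])" if "x \<in> T_scal k n" for x
    using T_scal_D(3)[OF assms(2) that] by (auto simp: sorted_iff_nth_mono nth_append)
  have "mset (map \<beta> [1..<Suc n]) = mset (map \<gamma> [1..<Suc n])"
    by (rule multiset_eqI) (simp only: count_list count)
  then have "map \<beta> [1..<Suc n] = map \<gamma> [1..<Suc n]"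
    using properties_for_sort[OF _ sorted[OF \<beta>], of "map \<gamma> [1..<Suc n]"]
      properties_for_sort[OF _ sorted[OF \<gamma>], of "map \<gamma> [1..<Suc n]"] by simp
  then have "\<beta> j = \<gamma> j" if "j \<in> {1..n}" for j
    using that by (auto simp only: map_eq_conv set_upt atLeastLessThanSuc_atLeastAtMost)
  then show "\<beta> = \<gamma>"
    using T_scal_D(6)[OF assms(2) \<beta>] T_scal_D(6)[OF assms(2) \<gamma>] by (metis ext)
qed

section \<open>Topology of the parametrization\<close>

lemma continuous_on_coeff_prod_turn:
  "finite A \<Longrightarrow> continuous_on UNIV (\<lambda>\<beta>::nat \<Rightarrow> real. coeff (\<Prod>j\<in>A. [:- turn (\<beta> j), 1:]) i)"
proof (induction A arbitrary: i rule: finite_induct)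
  case (insert a A)
  have "coeff (\<Prod>j\<in>insert a A. [:- turn (\<beta> j), 1:]) i =
      - turn (\<beta> a) * coeff (\<Prod>j\<in>A. [:- turn (\<beta> j), 1:]) i +
      (if i = 0 then 0 else coeff (\<Prod>j\<in>A. [:- turn (\<beta> j), 1:]) (i - 1))" for \<beta> :: "nat \<Rightarrow> real"
    using insert.hyps by (cases i) (auto simp: coeff_pCons)
  moreover have "continuous_on UNIV (\<lambda>\<beta>::nat \<Rightarrow> real. turn (\<beta> a))"
    unfolding cis_conv_exp
    by (intro continuous_intros continuous_on_product_coordinates)
  ultimately show ?case
    using insert.IH[of i] insert.IH[of "i - 1"]
    by (cases "i = 0") (auto intro!: continuous_intros)
qed simp

lemma continuous_on_coeff_Pi_poly:
  assumes "n \<ge> 1" "k \<in> {1,2}"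
  shows "continuous_on (T_scal k n) (\<lambda>\<beta>. coeff (Pi_poly n \<beta>) i)"
proof -
  have "continuous_on (T_scal k n) (\<lambda>\<beta>. Re (coeff (turn_poly n \<beta>) i))"
    unfolding turn_poly_def
    by (intro continuous_on_Re continuous_on_subset[OF continuous_on_coeff_prod_turn]) auto
  moreover have "Re (coeff (turn_poly n \<beta>) i) = coeff (Pi_poly n \<beta>) i" if "\<beta> \<in> T_scal k n" for \<beta>
    by (metis coeff_Pi_poly[OF assms that] Re_complex_of_real)
  ultimately show ?thesis by (simp cong: continuous_on_cong)
qed

text \<open>A closed subset of the cube of all sequences in \<open>[0,1]\<close>, which is compact
  by Tychonoff.\<close>

lemma compact_T_scal:
  assumes "k \<in> {1,2}"
  shows "compact (T_scal k n)"
proof -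
  have [simp]: "continuous_on UNIV (\<lambda>\<beta>::nat \<Rightarrow> real. \<beta> j)" for j
    by (rule continuous_on_product_coordinates)
  let ?P = "PiE UNIV (\<lambda>_. {0..1}) :: (nat \<Rightarrow> real) set"
  have "compactin (product_topology (\<lambda>_. euclidean) UNIV) ?P"
    unfolding compactin_PiE by simp
  then have P: "compact ?P"
    unfolding euclidean_product_topology by simp
  have c1: "closed (\<Inter>j\<in>- {1..n}. {\<beta>::nat \<Rightarrow> real. \<beta> j = 0})"
    by (intro closed_INT ballI closed_Collect_eq) auto
  have c2: "closed (\<Inter>i\<in>{1..n}. \<Inter>j\<in>{i..n}. {\<beta>::nat \<Rightarrow> real. \<beta> i \<le> \<beta> j})"
    by (intro closed_INT ballI closed_Collect_le) auto
  have c3: "closed {\<beta>::nat \<Rightarrow> real. k = 2 \<longrightarrow> \<beta> 1 = 0}"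
    by (cases "k = 2") (auto intro!: closed_Collect_eq)
  have c4: "closed (\<Inter>j\<in>{k..n}. {\<beta>::nat \<Rightarrow> real. \<beta> j + \<beta> (n + k - j) = 1})"
    by (intro closed_INT ballI closed_Collect_eq) (auto intro!: continuous_intros)
  have "T_scal k n = ?P \<inter> ((\<Inter>j\<in>- {1..n}. {\<beta>. \<beta> j = 0})
      \<inter> (\<Inter>i\<in>{1..n}. \<Inter>j\<in>{i..n}. {\<beta>. \<beta> i \<le> \<beta> j}) \<inter> {\<beta>. k = 2 \<longrightarrow> \<beta> 1 = 0}
      \<inter> (\<Inter>j\<in>{k..n}. {\<beta>. \<beta> j + \<beta> (n + k - j) = 1}))" (is "_ = ?R")
  proof (intro equalityI subsetI)
    fix \<beta> assume \<beta>: "\<beta> \<in> T_scal k n"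
    show "\<beta> \<in> ?R" using T_scal_D[OF assms \<beta>] by auto
  next
    fix \<beta> assume "\<beta> \<in> ?R"
    then show "\<beta> \<in> T_scal k n"
      unfolding T_scal_iff[OF assms] by (auto simp: coord_space_def mono_on_def PiE_iff)
  qed
  then show ?thesis
    using P c1 c2 c3 c4 by (simp only: compact_Int_closed closed_Int)
qed

text \<open>Reading off the entries is a continuous injection into a product of real lines.\<close>

lemma Hausdorff_mat_topology: "Hausdorff_space (mat_topology n)"
proof -
  let ?f = "\<lambda>A (i,j). if i < n \<and> j < n then A $$ (i,j) else 0 :: real"
  have top: "topspace (mat_topology n) = carrier_mat n n"
    by (simp add: mat_topology_def topspace_pullback_topology)
  have "continuous_map (mat_topology n) euclidean (id \<circ> ?f)"
    unfolding mat_topology_def by (rule continuous_map_pullback) simp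
  moreover have "inj_on ?f (carrier_mat n n)"
  proof (rule inj_onI)
    fix A B :: "real mat" assume "A \<in> carrier_mat n n" "B \<in> carrier_mat n n" and eq: "?f A = ?f B"
    moreover have "A $$ (i,j) = B $$ (i,j)" if "i < n" "j < n" for i j
      using fun_cong[OF eq, of "(i,j)"] that by simp
    ultimately show "A = B" by (intro eq_matI) auto
  qed
  ultimately show ?thesis
    using Hausdorff_space_injective_preimage[of euclidean "mat_topology n" ?f] by (simp add: top)
qed

lemma continuous_map_S_mat_Pi_poly:
  assumes "n \<ge> 1" "k \<in> {1,2}"
  shows "continuous_map (top_of_set (T_scal k n)) (mat_topology n) (S_mat n \<circ> Pi_poly n)"
  unfolding mat_topology_def
proof (rule continuous_map_pullback')
  let ?f = "\<lambda>A (i,j). if i < n \<and> j < n then A $$ (i,j) else 0 :: real"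
  have "continuous_on (T_scal k n) (?f \<circ> (S_mat n \<circ> Pi_poly n))"
  proof (rule continuous_on_coordinatewise_then_product)
    fix ij :: "nat \<times> nat"
    obtain i j where ij: "ij = (i,j)" by force
    show "continuous_on (T_scal k n) (\<lambda>\<beta>. (?f \<circ> (S_mat n \<circ> Pi_poly n)) \<beta> ij)"
      using continuous_on_coeff_Pi_poly[OF assms]
      by (cases "i < n \<and> j < n"; cases "i \<le> j") (auto simp: ij)
  qed
  then show "continuous_map (top_of_set (T_scal k n)) euclidean (?f \<circ> (S_mat n \<circ> Pi_poly n))"
    by simp
qed auto

lemma homeomorphic_map_T_HOR:
  assumes "n \<ge> 1" "k \<in> {1,2}"
  shows "homeomorphic_map (top_of_set (T_scal k n)) (subtopology (mat_topology n) (T_HOR k n))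
    (S_mat n \<circ> Pi_poly n)"
proof (rule continuous_imp_homeomorphic_map)
  have img: "(S_mat n \<circ> Pi_poly n) ` T_scal k n = T_HOR k n"
    by (simp add: T_HOR_def T_pol_def image_image)
  then show "continuous_map (top_of_set (T_scal k n)) (subtopology (mat_topology n) (T_HOR k n))
      (S_mat n \<circ> Pi_poly n)"
    using continuous_map_S_mat_Pi_poly[OF assms] by (auto simp: continuous_map_in_subtopology)
  show "compact_space (top_of_set (T_scal k n))"
    using compact_T_scal[OF assms(2)] by (simp add: compact_space_subtopology)
  show "Hausdorff_space (subtopology (mat_topology n) (T_HOR k n))"
    by (intro Hausdorff_space_subtopology Hausdorff_mat_topology)
  have "T_HOR k n \<subseteq> carrier_mat n n" by (auto simp: T_HOR_def)
  then show "(S_mat n \<circ> Pi_poly n) ` topspace (top_of_set (T_scal k n)) =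
      topspace (subtopology (mat_topology n) (T_HOR k n))"
    using img by (auto simp: mat_topology_def topspace_pullback_topology)
  show "inj_on (S_mat n \<circ> Pi_poly n) (topspace (top_of_set (T_scal k n)))"
    using comp_inj_on[OF inj_on_Pi_poly[OF assms]] inj_on_S_mat[OF assms] by (simp add: T_pol_def)
qed

section \<open>Uniqueness of continuously chosen angles\<close>

text \<open>A connectedness argument on \<open>[0,1)\<close>, where the roots are distinct: the set
  on which \<open>c\<close> follows \<open>b j\<close> and its complement are both closed. The end
  point, where roots may collide, follows by continuity.\<close>

lemma continuous_turn_lift_unique:
  fixes b :: "nat \<Rightarrow> real \<Rightarrow> real" and c :: "real \<Rightarrow> real"
  assumes b: "\<And>i. i \<in> I \<Longrightarrow> continuous_on {0..1} (b i)" and c: "continuous_on {0..1} c"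
    and fin: "finite I" and j: "j \<in> I"
    and inj: "\<And>r. r \<in> {0..<1} \<Longrightarrow> inj_on (\<lambda>i. turn (b i r)) I"
    and root: "\<And>r. r \<in> {0..1} \<Longrightarrow> turn (c r) \<in> (\<lambda>i. turn (b i r)) ` I"
    and start: "c 0 = b j 0" and r: "r \<in> {0..1}"
  shows "c r = b j r"
proof -
  let ?U = "top_of_set {0..<1::real}"
  have sub: "{0..<1::real} \<subseteq> {0..1}" by auto
  have b': "continuous_on {0..<1} (b i)" if "i \<in> I" for i
    using continuous_on_subset[OF b[OF that] sub] .
  have c': "continuous_on {0..<1} c" using continuous_on_subset[OF c sub] .
  \<comment> \<open>\<open>A\<close> is agreement with \<open>b j\<close>, \<open>B\<close> means
    that the root belongs to another index, and \<open>C\<close> catches other branches of the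
    angle. Stating \<open>C\<close> as distance at least \<open>1\<close>, the smallest possible
    jump, makes it closed.\<close>
  define A where "A = {r\<in>{0..<1}. c r - b j r = 0}"
  define B where "B = (\<Union>i\<in>I - {j}. {r\<in>{0..<1}. turn (c r) - turn (b i r) = 0})"
  define C where "C = {0..<1} \<inter> (\<lambda>r. \<bar>c r - b j r\<bar>) -` {1..}"
  have "closedin ?U A"
    unfolding A_def by (intro continuous_closedin_preimage_constant continuous_intros c' b' j)
  moreover have "closedin ?U B"
    unfolding B_def
  proof (intro closedin_Union ballI)
    fix T assume "T \<in> (\<lambda>i. {r\<in>{0..<1}. turn (c r) - turn (b i r) = 0}) ` (I - {j})"
    then obtain i where i: "i \<in> I" "T = {r\<in>{0..<1}. turn (c r) - turn (b i r) = 0}" by auto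
    then show "closedin ?U T"
      unfolding i(2) cis_conv_exp
      by (intro continuous_closedin_preimage_constant continuous_intros c' b')
  qed (use fin in auto)
  moreover have "closedin ?U C"
    unfolding C_def by (intro continuous_closedin_preimage continuous_intros c' b' j)
  ultimately have "closedin ?U A" "closedin ?U (B \<union> C)" by auto
  moreover have "{0..<1} \<subseteq> A \<union> (B \<union> C)"
  proof
    fix s :: real assume s: "s \<in> {0..<1}"
    then obtain i where i: "i \<in> I" "turn (c s) = turn (b i s)" using root[of s] by auto
    show "s \<in> A \<union> (B \<union> C)"
    proof (cases "i = j")
      case True
      then obtain m where m: "c s - b j s = of_int m"
        using i(2) unfolding turn_eq_iff by (auto elim: Ints_cases)
      show ?thesis
      proof (cases "m = 0")
        case True
        then show ?thesis using m s by (auto simp: A_def)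
      next
        case False
        then have "1 \<le> \<bar>m\<bar>" by linarith
        then have "1 \<le> \<bar>c s - b j s\<bar>" unfolding m by (metis of_int_abs of_int_le_iff of_int_1)
        then show ?thesis using s by (auto simp: C_def)
      qed
    next
      case False
      then show ?thesis using i s by (auto simp: B_def)
    qed
  qed
  moreover have "A \<inter> (B \<union> C) = {}"
    using inj_onD[OF inj _ j] by (fastforce simp: A_def B_def C_def)
  moreover have "0 \<in> A" using start by (simp add: A_def)
  ultimately have "B \<union> C = {}"
    using connected_closedin[of "{0..<1::real}"] by (metis connected_Ico empty_iff)
  then have eq: "{0..<1} \<subseteq> {r\<in>{0..1}. c r - b j r = 0}"
    using \<open>{0..<1} \<subseteq> A \<union> (B \<union> C)\<close> by (auto simp: A_def)
  \<comment> \<open>The agreement set is closed in \<open>[0,1]\<close> and contains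
    \<open>[0,1)\<close>, hence also \<open>1\<close>.\<close>
  have "closedin (top_of_set {0..1}) {r\<in>{0..1}. c r - b j r = 0}"
    by (intro continuous_closedin_preimage_constant continuous_intros c b j)
  then have "closed {r\<in>{0..1}. c r - b j r = 0}"
    by (rule closedin_closed_trans) simp
  from closure_minimal[OF eq this] have "{0..1} \<subseteq> {r\<in>{0..1}. c r - b j r = 0}" by simp
  then show ?thesis using r by auto
qed

section \<open>The matrices of the HOR simplices\<close>

lemma T_HOR_cases:
  assumes "S \<in> T_HOR k n"
  obtains \<beta> where "\<beta> \<in> T_scal k n" "S = S_mat n (Pi_poly n \<beta>)"
  using assms by (auto simp: T_HOR_def T_pol_def)

lemma S_mat_Pi_poly_inject:
  assumes "n \<ge> 1" "k \<in> {1,2}" "\<beta> \<in> T_scal k n" "\<gamma> \<in> T_scal k n"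
    "S_mat n (Pi_poly n \<beta>) = S_mat n (Pi_poly n \<gamma>)"
  shows "\<beta> = \<gamma>"
proof -
  have "Pi_poly n \<beta> = Pi_poly n \<gamma>"
    using assms(3,4) by (intro inj_onD[OF inj_on_S_mat[OF assms(1,2)] assms(5)]) (simp_all add: T_pol_def)
  then show ?thesis
    using inj_onD[OF inj_on_Pi_poly[OF assms(1,2)]] assms(3,4) by blast
qed

lemma R_mat_S_mat:
  assumes "n \<ge> 1" "k \<in> {1,2}" "\<beta> \<in> T_scal k n"
  shows "R_mat k n (S_mat n (Pi_poly n \<beta>)) = companion n (Pi_poly n \<beta>)"
  unfolding R_mat_def using inv_into_f_f[OF inj_on_S_mat[OF assms(1,2)]] assms(3)
  by (simp add: T_pol_def)

lemma has_eigenvalues_R_mat: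
  assumes "n \<ge> 1" "k \<in> {1,2}" "\<beta> \<in> T_scal k n"
  shows "has_eigenvalues n (cmat (R_mat k n (S_mat n (Pi_poly n \<beta>)))) (\<lambda>j. turn (\<beta> j))"
  unfolding R_mat_S_mat[OF assms]
  using degree_Pi_poly[OF assms] coeff_Pi_poly_n[OF assms] map_poly_Pi_poly[OF assms]
  by (intro has_eigenvalues_companion) (auto simp: turn_poly_def)

lemma R_mat_carrier:
  assumes "n \<ge> 1" "k \<in> {1,2}" "S \<in> T_HOR k n"
  shows "R_mat k n S \<in> carrier_mat n n"
  using assms R_mat_S_mat[OF assms(1,2)] by (auto elim!: T_HOR_cases)

lemma int_T_HOR_iff:
  assumes "n \<ge> 1" "k \<in> {1,2}" "\<beta> \<in> T_scal k n"
  shows "S_mat n (Pi_poly n \<beta>) \<in> int_T_HOR k n \<longleftrightarrow> inj_on (\<lambda>j. turn (\<beta> j)) {1..n}"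
  unfolding int_T_HOR_def rel_interior_T_scal[OF assms(1,2)] inj_turn_iff_strict[OF assms]
  using S_mat_Pi_poly_inject[OF assms] assms(3) by auto

lemma distinct_eigenvalues_R_mat_iff:
  assumes "n \<ge> 1" "k \<in> {1,2}" "S \<in> T_HOR k n"
  shows "distinct_eigenvalues n (cmat (R_mat k n S)) \<longleftrightarrow> S \<in> int_T_HOR k n"
proof -
  obtain \<beta> where \<beta>: "\<beta> \<in> T_scal k n" "S = S_mat n (Pi_poly n \<beta>)"
    using assms(3) by (rule T_HOR_cases)
  then show ?thesis
    using distinct_eigenvalues_iff_inj[OF _ has_eigenvalues_R_mat[OF assms(1,2) \<beta>(1)]]
      R_mat_carrier[OF assms] int_T_HOR_iff[OF assms(1,2) \<beta>(1)] by simp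
qed

lemma norm_eigenvalue_companion_Pi_poly:
  assumes "n \<ge> 1" "k \<in> {1,2}" "\<beta> \<in> T_scal k n"
    "eigenvalue (cmat (companion n (Pi_poly n \<beta>))) \<mu>"
  shows "norm \<mu> = 1"
  using eigenvalue_iff_of_has_eigenvalues[OF _ has_eigenvalues_R_mat[OF assms(1-3)], of \<mu>] assms(4)
  by (auto simp: R_mat_S_mat[OF assms(1-3)])

lemma T_HOR_subset_T_mat:
  assumes "n \<ge> 1" "k \<in> {1,2}"
  shows "T_HOR k n \<subseteq> T_mat n"
proof
  fix S assume "S \<in> T_HOR k n"
  then obtain \<beta> where \<beta>: "\<beta> \<in> T_scal k n" "S = S_mat n (Pi_poly n \<beta>)"
    by (rule T_HOR_cases)
  show "S \<in> T_mat n"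
    unfolding \<beta>(2)
  proof (rule S_mat_in_T_mat[OF degree_Pi_poly[OF assms \<beta>(1)] coeff_Pi_poly_n[OF assms \<beta>(1)]])
    show "(-1) ^ k \<in> {1, -1 :: real}" using assms(2) by auto
  qed (rule coeff_Pi_poly_palindromic[OF assms \<beta>(1)] norm_eigenvalue_companion_Pi_poly[OF assms \<beta>(1)];
      assumption)+
qed

lemma R_mat_properties:
  assumes "n \<ge> 1" "k \<in> {1,2}" "S \<in> T_HOR k n"
  shows "invertible_mat (R_mat k n S)" "regular_mat (cmat (R_mat k n S))"
    "eigenvalue (cmat (R_mat k n S)) \<mu> \<Longrightarrow> \<mu> \<in> sphere 0 1"
    "(- 1) ^ k \<cdot>\<^sub>m (the (mat_inverse S) * transpose_mat S) = R_mat k n S ^\<^sub>m n"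
    "semisimple_mat (cmat (R_mat k n S)) \<longleftrightarrow> distinct_eigenvalues n (cmat (R_mat k n S))"
proof -
  obtain \<beta> where \<beta>: "\<beta> \<in> T_scal k n" "S = S_mat n (Pi_poly n \<beta>)"
    using assms(3) by (rule T_HOR_cases)
  have R: "R_mat k n S = companion n (Pi_poly n \<beta>)"
    unfolding \<beta>(2) by (rule R_mat_S_mat[OF assms(1,2) \<beta>(1)])
  have p0: "coeff (Pi_poly n \<beta>) 0 \<noteq> 0"
    using coeff_Pi_poly_palindromic[OF assms(1,2) \<beta>(1), of 0] coeff_Pi_poly_n[OF assms(1,2) \<beta>(1)] by simp
  have C: "cmat (companion n (Pi_poly n \<beta>)) \<in> carrier_mat n n" by simp
  show "invertible_mat (R_mat k n S)"
    unfolding R using degree_Pi_poly[OF assms(1,2) \<beta>(1)] coeff_Pi_poly_n[OF assms(1,2) \<beta>(1)] p0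
    by (rule invertible_companion)
  show "regular_mat (cmat (R_mat k n S))"
    unfolding R by (rule regular_mat_of_eigenspaces[OF C dim_eigenspace_companion])
  show "eigenvalue (cmat (R_mat k n S)) \<mu> \<Longrightarrow> \<mu> \<in> sphere 0 1"
    unfolding R using norm_eigenvalue_companion_Pi_poly[OF assms(1,2) \<beta>(1)] by simp
  show "(- 1) ^ k \<cdot>\<^sub>m (the (mat_inverse S) * transpose_mat S) = R_mat k n S ^\<^sub>m n"
    unfolding R unfolding \<beta>(2)
    using coeff_Pi_poly_n[OF assms(1,2) \<beta>(1)] coeff_Pi_poly_palindromic[OF assms(1,2) \<beta>(1)]
    by (rule monodromy_S_mat)
  show "semisimple_mat (cmat (R_mat k n S)) \<longleftrightarrow> distinct_eigenvalues n (cmat (R_mat k n S))"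
    unfolding R by (rule semisimple_iff_distinct_eigenvalues[OF C dim_eigenspace_companion])
qed

lemma affine_linear_R_mat:
  assumes "n \<ge> 1" "k \<in> {1,2}"
  shows "affine_linear_on n (T_HOR k n) (R_mat k n)"
proof -
  \<comment> \<open>The first row of \<open>R_mat\<close> is minus the first row of \<open>S\<close>
    shifted by one place. Its last entry, minus the constant coefficient, equals
    \<open>(-1)^k\<close> and goes into \<open>C\<close> with the subdiagonal.\<close>
  define L :: "real mat \<Rightarrow> real mat" where
    "L A = Matrix.mat n n (\<lambda>(i,j). if i = 0 \<and> j + 1 < n then - A $$ (0, j + 1) else 0)" for A
  define C :: "real mat" where
    "C = Matrix.mat n n (\<lambda>(i,j). if i = 0 then (if j + 1 = n then (-1) ^ k else 0)
        else if i = j + 1 then 1 else 0)"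
  have "R_mat k n S = L S + C" if "S \<in> T_HOR k n" for S
  proof -
    obtain \<beta> where \<beta>: "\<beta> \<in> T_scal k n" "S = S_mat n (Pi_poly n \<beta>)"
      using \<open>S \<in> T_HOR k n\<close> by (rule T_HOR_cases)
    have p0: "coeff (Pi_poly n \<beta>) 0 = - ((-1) ^ k)"
      using coeff_Pi_poly_palindromic[OF assms \<beta>(1), of 0] coeff_Pi_poly_n[OF assms \<beta>(1)] by simp
    show ?thesis
      unfolding \<beta>(2) R_mat_S_mat[OF assms \<beta>(1)]
    proof (rule eq_matI)
      fix i j assume "i < dim_row (L (S_mat n (Pi_poly n \<beta>)) + C)" "j < dim_col (L (S_mat n (Pi_poly n \<beta>)) + C)"
      then have ij: "i < n" "j < n" by (auto simp: C_def)
      show "companion n (Pi_poly n \<beta>) $$ (i, j) = (L (S_mat n (Pi_poly n \<beta>)) + C) $$ (i, j)"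
      proof (cases "j + 1 = n")
        case True
        then show ?thesis using ij p0 by (auto simp: L_def C_def)
      next
        case False
        then show ?thesis using ij by (auto simp: L_def C_def)
      qed
    qed (auto simp: C_def)
  qed
  moreover have "L (A + B) = L A + L B" if "A \<in> carrier_mat n n" "B \<in> carrier_mat n n" for A B
    using that by (intro eq_matI) (auto simp: L_def)
  moreover have "L (c \<cdot>\<^sub>m A) = c \<cdot>\<^sub>m L A" if "A \<in> carrier_mat n n" for c A
    using that by (intro eq_matI) (auto simp: L_def)
  moreover have "C \<in> carrier_mat n n" "L \<in> carrier_mat n n \<rightarrow> carrier_mat n n"
    by (auto simp: C_def L_def)
  ultimately show ?thesis unfolding affine_linear_on_def by blast
qed

lemma one_mat_mem_int_T_HOR:
  assumes "n \<ge> 1" "k \<in> {1,2}"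
  shows "1\<^sub>m n \<in> int_T_HOR k n"
  using S_mat_center[OF assms] strict_center[OF assms] center_mem[OF assms]
  unfolding int_T_HOR_def rel_interior_T_scal[OF assms]
  by (metis (mono_tags, lifting) comp_apply image_eqI mem_Collect_eq)

lemma one_mat_mem_T_HOR:
  assumes "n \<ge> 1" "k \<in> {1,2}"
  shows "1\<^sub>m n \<in> T_HOR k n"
  using S_mat_center[OF assms] center_mem[OF assms] unfolding T_HOR_def T_pol_def
  by (metis image_eqI)

text \<open>The coefficient symmetries for \<open>k = 1\<close> and \<open>k = 2\<close> have
  opposite signs, so each common coefficient strictly between the ends equals its own
  negative.\<close>

lemma T_HOR_inter:
  assumes "n \<ge> 1"
  shows "T_HOR 1 n \<inter> T_HOR 2 n = {1\<^sub>m n}"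
proof (intro equalityI subsetI)
  fix S assume "S \<in> T_HOR 1 n \<inter> T_HOR 2 n"
  then obtain \<beta> \<gamma> where \<beta>: "\<beta> \<in> T_scal 1 n" "S = S_mat n (Pi_poly n \<beta>)"
    and \<gamma>: "\<gamma> \<in> T_scal 2 n" "S = S_mat n (Pi_poly n \<gamma>)"
    by (auto elim!: T_HOR_cases)
  let ?p = "Pi_poly n \<beta>" and ?q = "Pi_poly n \<gamma>"
  have eq: "coeff ?p i = coeff ?q i" if "1 \<le> i" "i \<le> n" for i
  proof -
    have "S_mat n ?p $$ (0, n - i) = S_mat n ?q $$ (0, n - i)" using \<beta>(2) \<gamma>(2) by simp
    with that show ?thesis by simp
  qed
  have zero: "coeff ?p i = 0" if "1 \<le> i" "i < n" for i
    using coeff_Pi_poly_palindromic[OF assms _ \<beta>(1), of i] coeff_Pi_poly_palindromic[OF assms _ \<gamma>(1), of i]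
      eq[of i] eq[of "n - i"] that by simp
  have "S = 1\<^sub>m n"
    unfolding \<beta>(2)
    by (rule eq_matI) (use zero coeff_Pi_poly_n[OF assms _ \<beta>(1)] in auto)
  then show "S \<in> {1\<^sub>m n}" by simp
qed (use one_mat_mem_T_HOR[OF assms] in auto)

lemma simplex_T_scal:
  assumes "n \<ge> 1" "k \<in> {1,2}"
  shows "\<exists>C c L. C \<subseteq> coord_space (dim_T_HOR k n) \<and> card C = dim_T_HOR k n + 1 \<and>
    \<not> affine_dependent C \<and> linear L \<and> bij_betw (\<lambda>x. c + L x) (convex hull C) (T_scal k n)"
proof (intro exI conjI)
  let ?m = "dim_T_HOR k n"
  show "half_vertex ?m ` {..<Suc ?m} \<subseteq> coord_space ?m"
    using half_vertex_mem by (auto simp: half_simplex_def)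
  show "card (half_vertex ?m ` {..<Suc ?m}) = ?m + 1"
    by (simp add: card_image inj_on_half_vertex)
  show "\<not> affine_dependent (half_vertex ?m ` {..<Suc ?m})"
    by (rule affine_independent_half_vertex)
  show "linear (unfold_linear k n)" by (rule linear_unfold_linear)
  show "bij_betw (\<lambda>x. unfold_const k n + unfold_linear k n x)
      (convex hull (half_vertex ?m ` {..<Suc ?m})) (T_scal k n)"
    using bij_betw_unfold[OF assms] by (simp only: convex_hull_half_vertex dim_T_HOR_eq[OF assms])
qed

section \<open>Paths, lifted angles and the spectrum\<close>

definition path_parameters ::
  "nat \<Rightarrow> nat \<Rightarrow> (real \<Rightarrow> real mat) \<Rightarrow> (real \<Rightarrow> nat \<Rightarrow> real) \<Rightarrow> bool" where
  "path_parameters k n S b \<longleftrightarrow>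
     (\<forall>r\<in>{0..1}. b r \<in> T_scal k n \<and> S r = S_mat n (Pi_poly n (b r))) \<and>
     (\<forall>j. continuous_on {0..1} (\<lambda>r. b r j)) \<and> b 0 = center k n \<and>
     (\<forall>r\<in>{0..<1}. inj_on (\<lambda>j. turn (b r j)) {1..n})"

text \<open>Composing the path with the inverse of the homeomorphism gives \<open>b\<close>;
  interior matrices are those whose roots are distinct.\<close>

lemma HOR_path_parameters:
  assumes "n \<ge> 1" "k \<in> {1,2}" "HOR_path k n S1 S"
  shows "\<exists>b. path_parameters k n S b"
proof -
  let ?X = "top_of_set (T_scal k n)" and ?Y = "subtopology (mat_topology n) (T_HOR k n)"
  have path: "continuous_map (top_of_set {0..1}) ?Y S" "S 0 = 1\<^sub>m n" "S ` {0..<1} \<subseteq> int_T_HOR k n"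
    using assms(3) by (auto simp: HOR_path_def pathin_def)
  obtain g where g: "homeomorphic_maps ?X ?Y (S_mat n \<circ> Pi_poly n) g"
    using homeomorphic_map_T_HOR[OF assms(1,2)] unfolding homeomorphic_map_maps by blast
  define b where "b = g \<circ> S"
  have "continuous_map ?Y ?X g" using g unfolding homeomorphic_maps_def by blast
  then have cm: "continuous_map (top_of_set {0..1}) ?X b"
    unfolding b_def by (rule continuous_map_compose[OF path(1)])
  then have cont: "continuous_on {0..1} b" by (simp add: continuous_map_in_subtopology)
  have mem: "b r \<in> T_scal k n" if "r \<in> {0..1}" for r
    using continuous_map_image_subset_topspace[OF cm] that by auto
  have S: "S r = S_mat n (Pi_poly n (b r))" if "r \<in> {0..1}" for r
  proof -
    have "S r \<in> topspace ?Y"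
      using path(1) that continuous_map_image_subset_topspace[OF path(1)] by auto
    then show ?thesis using g by (simp add: homeomorphic_maps_def b_def)
  qed
  have "continuous_on {0..1} (\<lambda>r. b r j)" for j
    using continuous_on_product_then_coordinatewise[of "{0..1}" b j] cont by simp
  moreover have "b 0 = center k n"
    using S_mat_Pi_poly_inject[OF assms(1,2) mem center_mem[OF assms(1,2)]] S[of 0] path(2)
      S_mat_center[OF assms(1,2)] by simp
  moreover have "inj_on (\<lambda>j. turn (b r j)) {1..n}" if "r \<in> {0..<1}" for r
  proof -
    have "S r \<in> int_T_HOR k n" "r \<in> {0..1}" using path(3) that by auto
    then show ?thesis using int_T_HOR_iff[OF assms(1,2) mem] S by metis
  qed
  ultimately show ?thesis unfolding path_parameters_def using mem S by blast
qed

text \<open>A lift is a continuous choice of angles \<open>(\<alpha> j r + j - k/2) / n\<close> of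
  roots, and \<open>\<alpha> j 0 = 0\<close> means that it starts at \<open>center\<close>. By
  \<open>continuous_turn_lift_unique\<close> it must be \<open>b r j\<close>; this settles existence
  and uniqueness together.\<close>

lemma eigenvalue_lift_iff:
  assumes "n \<ge> 1" "k \<in> {1,2}" and params: "path_parameters k n S b"
  shows "eigenvalue_lift k n S \<alpha> \<longleftrightarrow>
    (\<forall>j\<in>{1..n}. \<forall>r\<in>{0..1}. \<alpha> j r = real n * b r j - real j + real k / 2)"
proof -
  have b: "\<And>r. r \<in> {0..1} \<Longrightarrow> b r \<in> T_scal k n"
    "\<And>r. r \<in> {0..1} \<Longrightarrow> S r = S_mat n (Pi_poly n (b r))"
    "\<And>j. continuous_on {0..1} (\<lambda>r. b r j)" "b 0 = center k n"
    "\<And>r. r \<in> {0..<1} \<Longrightarrow> inj_on (\<lambda>j. turn (b r j)) {1..n}"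
    using params by (auto simp: path_parameters_def)
  show ?thesis
  proof
    assume lift: "eigenvalue_lift k n S \<alpha>"
    show "\<forall>j\<in>{1..n}. \<forall>r\<in>{0..1}. \<alpha> j r = real n * b r j - real j + real k / 2"
    proof (intro ballI)
      fix j and r :: real assume j: "j \<in> {1..n}" and r: "r \<in> {0..1}"
      let ?c = "\<lambda>j r. (\<alpha> j r + real j - real k / 2) / real n"
      have "?c j r = b r j"
      proof (rule continuous_turn_lift_unique[where I = "{1..n}" and b = "\<lambda>j r. b r j" and c = "?c j"])
        show "continuous_on {0..1} (?c j)"
          using lift j assms(1) by (auto simp: eigenvalue_lift_def intro!: continuous_intros)
        show "?c j 0 = b 0 j"
          using lift j by (simp add: eigenvalue_lift_def b(4) center_def)
        fix s :: real assume s: "s \<in> {0..1}"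
        have "has_eigenvalues n (cmat (R_mat k n (S s))) (\<lambda>j. turn (?c j s))"
          using lift s by (simp add: eigenvalue_lift_def)
        moreover have "has_eigenvalues n (cmat (R_mat k n (S s))) (\<lambda>j. turn (b s j))"
          unfolding b(2)[OF s] by (rule has_eigenvalues_R_mat[OF assms(1,2) b(1)[OF s]])
        moreover have "cmat (R_mat k n (S s)) \<in> carrier_mat n n"
          unfolding b(2)[OF s] R_mat_S_mat[OF assms(1,2) b(1)[OF s]] by simp
        ultimately have "(\<lambda>j. turn (?c j s)) ` {1..n} = (\<lambda>j. turn (b s j)) ` {1..n}"
          using eigenvalue_iff_of_has_eigenvalues by blast
        then show "turn (?c j s) \<in> (\<lambda>j. turn (b s j)) ` {1..n}" using j by blast
      qed (use b(3,5) j r in auto)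
      then show "\<alpha> j r = real n * b r j - real j + real k / 2"
        using assms(1) by (simp add: field_simps)
    qed
  next
    assume \<alpha>: "\<forall>j\<in>{1..n}. \<forall>r\<in>{0..1}. \<alpha> j r = real n * b r j - real j + real k / 2"
    show "eigenvalue_lift k n S \<alpha>"
      unfolding eigenvalue_lift_def
    proof (intro conjI ballI)
      fix j assume j: "j \<in> {1..n}"
      have "continuous_on {0..1} (\<lambda>r. real n * b r j - real j + real k / 2)"
        by (intro continuous_intros b(3))
      then show "continuous_on {0..1} (\<alpha> j)"
        by (rule continuous_on_eq) (use \<alpha> j in auto)
      show "\<alpha> j 0 = 0" using \<alpha> j by (simp add: b(4) center_def)
    next
      fix r :: real assume r: "r \<in> {0..1}"
      have "cis (- 2 * pi * (\<alpha> j r + real j - real k / 2) / real n) = turn (b r j)" if "j \<in> {1..n}" for j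
      proof -
        have "\<alpha> j r = real n * b r j - real j + real k / 2" using \<alpha> that r by blast
        then show ?thesis using that by (simp add: mult.assoc)
      qed
      then show "has_eigenvalues n (cmat (R_mat k n (S r)))
          (\<lambda>j. cis (- 2 * pi * (\<alpha> j r + real j - real k / 2) / real n))"
        using has_eigenvalues_R_mat[OF assms(1,2) b(1)[OF r]] unfolding b(2)[OF r]
        by (simp add: has_eigenvalues_def)
    qed
  qed
qed

text \<open>The path enters only through \<open>b 1\<close>, which injectivity of the
  parametrization identifies with the parameter of \<open>S1\<close>.\<close>

lemma eigenvalue_lift_end:
  assumes "n \<ge> 1" "k \<in> {1,2}" "HOR_path k n S1 S" "eigenvalue_lift k n S \<alpha>"
    "\<beta> \<in> T_scal k n" "S1 = S_mat n (Pi_poly n \<beta>)" "j \<in> {1..n}"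
  shows "\<alpha> j 1 = real n * \<beta> j - real j + real k / 2"
proof -
  obtain b where params: "path_parameters k n S b"
    using HOR_path_parameters[OF assms(1-3)] by blast
  then have b: "b 1 \<in> T_scal k n" "S 1 = S_mat n (Pi_poly n (b 1))"
    by (auto simp: path_parameters_def)
  have "S 1 = S1" using assms(3) by (simp add: HOR_path_def)
  then have "b 1 = \<beta>"
    using S_mat_Pi_poly_inject[OF assms(1,2) b(1) assms(5)] b(2) assms(6) by simp
  then show ?thesis
    using eigenvalue_lift_iff[OF assms(1,2) params] assms(4,7) by auto
qed

lemma eigenvalue_lift_ex1:
  assumes "n \<ge> 1" "k \<in> {1,2}" "HOR_path k n S1 S"
  shows "\<exists>\<alpha>. eigenvalue_lift k n S \<alpha> \<and> (\<forall>\<alpha>'. eigenvalue_lift k n S \<alpha>' \<longrightarrow>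
     (\<forall>j\<in>{1..n}. \<forall>r\<in>{0..1}. \<alpha>' j r = \<alpha> j r))"
proof -
  obtain b where b: "path_parameters k n S b"
    using HOR_path_parameters[OF assms] by blast
  show ?thesis
    by (rule exI[of _ "\<lambda>j r. real n * b r j - real j + real k / 2"])
      (simp add: eigenvalue_lift_iff[OF assms(1,2) b])
qed

text \<open>By \<open>eigenvalue_lift_end\<close> all paths and lifts give the same multiset; the
  given pair shows that there is one.\<close>

lemma HOR_Sp_eq:
  assumes "n \<ge> 1" "k \<in> {1,2}" "S1 \<in> T_HOR k n" "HOR_path k n S1 S" "eigenvalue_lift k n S \<alpha>"
  shows "HOR_Sp k n S1 = image_mset (\<lambda>j. \<alpha> j 1) (mset_set {1..n})"
proof -
  obtain \<beta> where \<beta>: "\<beta> \<in> T_scal k n" "S1 = S_mat n (Pi_poly n \<beta>)"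
    using assms(3) by (rule T_HOR_cases)
  have "image_mset (\<lambda>j. \<alpha>' j 1) (mset_set {1..n}) = image_mset (\<lambda>j. \<alpha> j 1) (mset_set {1..n})"
    if "HOR_path k n S1 S'" "eigenvalue_lift k n S' \<alpha>'" for S' \<alpha>'
    using eigenvalue_lift_end[OF assms(1,2) that \<beta>] eigenvalue_lift_end[OF assms(1,2,4,5) \<beta>]
    by (intro image_mset_cong) auto
  then show ?thesis
    unfolding HOR_Sp_def using assms(4,5) by (intro the_equality) blast+
qed

lemma HOR_path_int:
  assumes "HOR_path k n S1 S" "r \<in> {0..<1}"
  shows "S r \<in> T_HOR k n" "S r \<in> int_T_HOR k n"
proof -
  show "S r \<in> int_T_HOR k n" using assms by (auto simp: HOR_path_def)
  then show "S r \<in> T_HOR k n"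
    using rel_interior_subset[of "T_scal k n"] by (auto simp: int_T_HOR_def T_HOR_def T_pol_def)
qed

theorem theorem1p3:
  fixes n k :: nat
  assumes "n \<ge> 1" and "k \<in> {1, 2}"
  shows
    "T_HOR 1 n \<subseteq> T_mat n \<and> T_HOR 2 n \<subseteq> T_mat n \<and>
     homeomorphic_map (top_of_set (T_scal k n)) (subtopology (mat_topology n) (T_HOR k n))
       (S_mat n \<circ> Pi_poly n) \<and>
     (\<exists>C c L. C \<subseteq> coord_space (dim_T_HOR k n) \<and> card C = dim_T_HOR k n + 1 \<and>
        \<not> affine_dependent C \<and> linear L \<and>
        bij_betw (\<lambda>x. c + L x) (convex hull C) (T_scal k n)) \<and>
     (odd n \<longrightarrow> dim_T_HOR 1 n = (n - 1) div 2 \<and> dim_T_HOR 2 n = (n - 1) div 2) \<and>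
     (even n \<longrightarrow> dim_T_HOR 1 n = n div 2 \<and> dim_T_HOR 2 n = (n - 2) div 2) \<and>
     (\<forall>S\<in>T_HOR k n.
        R_mat k n S \<in> carrier_mat n n \<and> invertible_mat (R_mat k n S) \<and>
        regular_mat (cmat (R_mat k n S)) \<and>
        (\<forall>\<mu>. eigenvalue (cmat (R_mat k n S)) \<mu> \<longrightarrow> \<mu> \<in> sphere 0 1) \<and>
        (- 1) ^ k \<cdot>\<^sub>m (the (mat_inverse S) * transpose_mat S) = R_mat k n S ^\<^sub>m n) \<and>
     affine_linear_on n (T_HOR k n) (R_mat k n) \<and>
     (\<forall>S\<in>T_HOR k n.
        (semisimple_mat (cmat (R_mat k n S)) \<longleftrightarrow> S \<in> int_T_HOR k n) \<and>
        (semisimple_mat (cmat (R_mat k n S)) \<longrightarrow> distinct_eigenvalues n (cmat (R_mat k n S)))) \<and>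
     1\<^sub>m n \<in> int_T_HOR k n \<and>
     has_eigenvalues n (cmat (R_mat k n (1\<^sub>m n)))
       (\<lambda>j. cis (- 2 * pi * (real j - real k / 2) / real n)) \<and>
     T_HOR 1 n \<inter> T_HOR 2 n = {1\<^sub>m n} \<and>
     (\<forall>S1\<in>T_HOR k n.
        (\<forall>S. HOR_path k n S1 S \<longrightarrow>
           (\<forall>r\<in>{0..<1}. distinct_eigenvalues n (cmat (R_mat k n (S r)))) \<and>
           (\<exists>\<alpha>. eigenvalue_lift k n S \<alpha> \<and>
              (\<forall>\<alpha>'. eigenvalue_lift k n S \<alpha>' \<longrightarrow>
                 (\<forall>j\<in>{1..n}. \<forall>r\<in>{0..1}. \<alpha>' j r = \<alpha> j r)))) \<and>
        (\<forall>S S' \<alpha> \<alpha>'.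
           HOR_path k n S1 S \<and> eigenvalue_lift k n S \<alpha> \<and>
           HOR_path k n S1 S' \<and> eigenvalue_lift k n S' \<alpha>' \<longrightarrow>
             (\<forall>j\<in>{1..n}. \<alpha> j 1 = \<alpha>' j 1)) \<and>
        (\<forall>S \<alpha>. HOR_path k n S1 S \<and> eigenvalue_lift k n S \<alpha> \<longrightarrow>
             HOR_Sp k n S1 = image_mset (\<lambda>j. \<alpha> j 1) (mset_set {1..n})))"
proof (intro conjI)
  show "T_HOR 1 n \<subseteq> T_mat n" "T_HOR 2 n \<subseteq> T_mat n"
    using T_HOR_subset_T_mat[OF assms(1)] by auto
  \<comment> \<open>The value of \<open>half_dim\<close> is \<open>n div 2\<close> for
    \<open>k = 1\<close> and \<open>(n - 1) div 2\<close> for \<open>k = 2\<close>.\<close>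
  show "odd n \<longrightarrow> dim_T_HOR 1 n = (n - 1) div 2 \<and> dim_T_HOR 2 n = (n - 1) div 2"
    "even n \<longrightarrow> dim_T_HOR 1 n = n div 2 \<and> dim_T_HOR 2 n = (n - 2) div 2"
    using dim_T_HOR_eq[OF assms(1), of 1] dim_T_HOR_eq[OF assms(1), of 2] assms(1)
    unfolding half_dim_def by (simp, presburger)+
  show "\<forall>S\<in>T_HOR k n.
        R_mat k n S \<in> carrier_mat n n \<and> invertible_mat (R_mat k n S) \<and>
        regular_mat (cmat (R_mat k n S)) \<and>
        (\<forall>\<mu>. eigenvalue (cmat (R_mat k n S)) \<mu> \<longrightarrow> \<mu> \<in> sphere 0 1) \<and>
        (- 1) ^ k \<cdot>\<^sub>m (the (mat_inverse S) * transpose_mat S) = R_mat k n S ^\<^sub>m n"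
    using R_mat_carrier[OF assms] R_mat_properties[OF assms] by blast
  show "\<forall>S\<in>T_HOR k n.
        (semisimple_mat (cmat (R_mat k n S)) \<longleftrightarrow> S \<in> int_T_HOR k n) \<and>
        (semisimple_mat (cmat (R_mat k n S)) \<longrightarrow> distinct_eigenvalues n (cmat (R_mat k n S)))"
    using R_mat_properties(5)[OF assms] distinct_eigenvalues_R_mat_iff[OF assms] by blast
  show "has_eigenvalues n (cmat (R_mat k n (1\<^sub>m n)))
      (\<lambda>j. cis (- 2 * pi * (real j - real k / 2) / real n))"
    using has_eigenvalues_R_mat[OF assms center_mem[OF assms]]
    by (simp add: S_mat_center[OF assms] has_eigenvalues_def center_def)
  show "\<forall>S1\<in>T_HOR k n.
        (\<forall>S. HOR_path k n S1 S \<longrightarrow>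
           (\<forall>r\<in>{0..<1}. distinct_eigenvalues n (cmat (R_mat k n (S r)))) \<and>
           (\<exists>\<alpha>. eigenvalue_lift k n S \<alpha> \<and>
              (\<forall>\<alpha>'. eigenvalue_lift k n S \<alpha>' \<longrightarrow>
                 (\<forall>j\<in>{1..n}. \<forall>r\<in>{0..1}. \<alpha>' j r = \<alpha> j r)))) \<and>
        (\<forall>S S' \<alpha> \<alpha>'.
           HOR_path k n S1 S \<and> eigenvalue_lift k n S \<alpha> \<and>
           HOR_path k n S1 S' \<and> eigenvalue_lift k n S' \<alpha>' \<longrightarrow>
             (\<forall>j\<in>{1..n}. \<alpha> j 1 = \<alpha>' j 1)) \<and>
        (\<forall>S \<alpha>. HOR_path k n S1 S \<and> eigenvalue_lift k n S \<alpha> \<longrightarrow>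
             HOR_Sp k n S1 = image_mset (\<lambda>j. \<alpha> j 1) (mset_set {1..n}))"
  proof (intro ballI conjI allI impI)
    fix S1 assume S1: "S1 \<in> T_HOR k n"
    obtain \<beta> where \<beta>: "\<beta> \<in> T_scal k n" "S1 = S_mat n (Pi_poly n \<beta>)"
      using S1 by (rule T_HOR_cases)
    show "distinct_eigenvalues n (cmat (R_mat k n (S r)))"
      if "HOR_path k n S1 S" "r \<in> {0..<1}" for S r
      using distinct_eigenvalues_R_mat_iff[OF assms HOR_path_int(1)[OF that]] HOR_path_int(2)[OF that]
      by simp
    show "\<alpha> j 1 = \<alpha>' j 1"
      if "HOR_path k n S1 S \<and> eigenvalue_lift k n S \<alpha> \<and>
           HOR_path k n S1 S' \<and> eigenvalue_lift k n S' \<alpha>'" "j \<in> {1..n}" for S S' \<alpha> \<alpha>' j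
      using that eigenvalue_lift_end[OF assms _ _ \<beta>, of S \<alpha> j] eigenvalue_lift_end[OF assms _ _ \<beta>, of S' \<alpha>' j]
      by simp
    show "HOR_Sp k n S1 = image_mset (\<lambda>j. \<alpha> j 1) (mset_set {1..n})"
      if "HOR_path k n S1 S \<and> eigenvalue_lift k n S \<alpha>" for S \<alpha>
      using that HOR_Sp_eq[OF assms S1] by blast
  qed (use eigenvalue_lift_ex1[OF assms] in blast)
qed (use homeomorphic_map_T_HOR[OF assms] simplex_T_scal[OF assms] affine_linear_R_mat[OF assms]
    one_mat_mem_int_T_HOR[OF assms] T_HOR_inter[OF assms(1)] in auto)

end
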